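(* Let $(\mathcal V,d,\mu)$ be the weighted homogeneous tree and let $f^{\sharp,q}$ be the sharp maximal function defined in the context. Let $p\in(1,\infty)$ and $p_0\in(1,p)$. There exists a positive constant $C$ such that $$\|f\|_{L^p}\le C\,\|f^{\sharp,p_0}\|_{L^p}\qquad\forall f\in L^{p_0}(\mu).$$
   Context: Tree. Let $m\ge 2$ be an integer and let $T=(\mathcal V,\mathcal E)$ be the infinite homogeneous tree of order $m+1$: a connected acyclic graph in which every vertex has exactly $m+1$ neighbours. Let $d(x,y)$ be the length of the shortest path between $x$ and $y$. Fix a doubly-infinite geodesic $g_0\subset\mathcal V$ (a connected subset such that each of its vertices has exactly two neighbours in it and the shortest path between any two of its vertices lies in it) and a map $N:g_0\to\mathbb Z$ with $|N(x)-N(y)|=d(x,y)$ for all $x,y\in g_0$. The level function is $\ell(x)=N(x')-d(x,x')$, where $x'$ is the vertex of $g_0$ closest to $x$. We say that $x$ lies below $y$ (and $y$ lies above $x$) if $\ell(x)=\ell(y)-d(x,y)$. The measure $\mu$ is defined by $\int_{\mathcal V} f\,\mathrm d\mu=\sum_{x\in\mathcal V}f(x)m^{\ell(x)}$. Functions are complex-valued and $L^p$ norms are taken with respect to $\mu$. Calderón–Zygmund sets. A (nonempty) set $\tilde R\subset \mathcal V$ is a Calderón–Zygmund set if either it is a single vertex (degenerate case) or there are $x_R\in\mathcal V$ and an integer $h\ge 1$ such that $\tilde R=\{x: x\text{ lies below }x_R,\ h/2\le \ell(x_R)-\ell(x)<4h\}$. Let $\mathcal R$ be the family of all Calderón–Zygmund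 sets. Sharp maximal function. For $q\in[1,\infty)$, $f\in L^q_{\mathrm{loc}}(\mu)$ and $x\in\mathcal V$, $$f^{\sharp,q}(x)=\sup_{\tilde R\in\mathcal R,\,x\in\tilde R}\Big(\frac1{\mu(\tilde R)}\int_{\tilde R}|f-f_{\tilde R}|^q\,\mathrm d\mu\Big)^{1/q},\qquad f_{\tilde R}=\frac1{\mu(\tilde R)}\int_{\tilde R}f\,\mathrm d\mu.$$ The inequality is trivially true when its right-hand side is infinite. *)

theory Defs
  imports "HOL-Analysis.Analysis"
begin

section \<open>Homogeneous trees\<close>

text \<open>A graph is given by its adjacency relation; the vertex set is the whole type. A path from
  \<open>x\<close> to \<open>y\<close> is the nonempty list of the vertices visited, so its length as a path is one less than
  its length as a list.\<close>

definition walk :: "('a \<Rightarrow> 'a \<Rightarrow> bool) \<Rightarrow> 'a \<Rightarrow> 'a list \<Rightarrow> 'a \<Rightarrow> bool" where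
  "walk E x xs y \<longleftrightarrow> xs \<noteq> [] \<and> hd xs = x \<and> last xs = y \<and> successively E xs"

definition tdist :: "('a \<Rightarrow> 'a \<Rightarrow> bool) \<Rightarrow> 'a \<Rightarrow> 'a \<Rightarrow> nat" where
  "tdist E x y = (LEAST n. \<exists>xs. walk E x xs y \<and> length xs = Suc n)"

definition shortest_path :: "('a \<Rightarrow> 'a \<Rightarrow> bool) \<Rightarrow> 'a \<Rightarrow> 'a list \<Rightarrow> 'a \<Rightarrow> bool" where
  "shortest_path E x xs y \<longleftrightarrow> walk E x xs y \<and> length xs = Suc (tdist E x y)"

definition simple_graph :: "('a \<Rightarrow> 'a \<Rightarrow> bool) \<Rightarrow> bool" where
  "simple_graph E \<longleftrightarrow> symp E \<and> irreflp E"

definition connected_in :: "('a \<Rightarrow> 'a \<Rightarrow> bool) \<Rightarrow> 'a set \<Rightarrow> bool" where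
  "connected_in E S \<longleftrightarrow> (\<forall>x\<in>S. \<forall>y\<in>S. \<exists>xs. walk E x xs y \<and> set xs \<subseteq> S)"

definition acyclic_graph :: "('a \<Rightarrow> 'a \<Rightarrow> bool) \<Rightarrow> bool" where
  "acyclic_graph E \<longleftrightarrow>
    \<not> (\<exists>xs. length xs \<ge> 3 \<and> distinct xs \<and> successively E xs \<and> E (last xs) (hd xs))"

text \<open>For \<open>m \<ge> 1\<close> such a tree is automatically infinite. As \<open>m + 1 \<noteq> 0\<close>, the cardinality
  condition entails that the set of neighbours is finite.\<close>

definition homogeneous_tree :: "('a \<Rightarrow> 'a \<Rightarrow> bool) \<Rightarrow> nat \<Rightarrow> bool" where
  "homogeneous_tree E m \<longleftrightarrow> simple_graph E \<and> connected_in E UNIV \<and> acyclic_graph E \<and>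
    (\<forall>x. card {y. E x y} = m + 1)"

definition infinite_geodesic :: "('a \<Rightarrow> 'a \<Rightarrow> bool) \<Rightarrow> 'a set \<Rightarrow> bool" where
  "infinite_geodesic E g \<longleftrightarrow> g \<noteq> {} \<and> connected_in E g \<and>
    (\<forall>x\<in>g. card {y\<in>g. E x y} = 2) \<and>
    (\<forall>x\<in>g. \<forall>y\<in>g. \<forall>xs. shortest_path E x xs y \<longrightarrow> set xs \<subseteq> g)"

section \<open>Level function and measure\<close>

definition level :: "('a \<Rightarrow> 'a \<Rightarrow> bool) \<Rightarrow> 'a set \<Rightarrow> ('a \<Rightarrow> int) \<Rightarrow> 'a \<Rightarrow> int" where
  "level E g N x = (let x' = arg_min_on (tdist E x) g in N x' - int (tdist E x x'))"

definition below :: "('a \<Rightarrow> 'a \<Rightarrow> bool) \<Rightarrow> 'a set \<Rightarrow> ('a \<Rightarrow> int) \<Rightarrow> 'a \<Rightarrow> 'a \<Rightarrow> bool" where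
  "below E g N x y \<longleftrightarrow> level E g N x = level E g N y - int (tdist E x y)"

definition tree_measure ::
    "('a \<Rightarrow> 'a \<Rightarrow> bool) \<Rightarrow> nat \<Rightarrow> 'a set \<Rightarrow> ('a \<Rightarrow> int) \<Rightarrow> 'a measure" where
  "tree_measure E m g N = point_measure UNIV (\<lambda>x. ennreal (real m powi level E g N x))"

section \<open>Lebesgue norms\<close>

text \<open>Powers with exponent \<open>p > 0\<close> of extended nonnegative numbers.\<close>

definition ennreal_powr :: "ennreal \<Rightarrow> real \<Rightarrow> ennreal" where
  "ennreal_powr a p = (if a = \<infinity> then \<infinity> else ennreal (enn2real a powr p))"

text \<open>The norm of an extended nonnegative function; a complex function \<open>f\<close> enters via its modulus.\<close>

definition Lp_norm :: "'a measure \<Rightarrow> real \<Rightarrow> ('a \<Rightarrow> ennreal) \<Rightarrow> ennreal" where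
  "Lp_norm M p u = ennreal_powr (\<integral>\<^sup>+ x. ennreal_powr (u x) p \<partial>M) (1 / p)"

definition Lp_space :: "'a measure \<Rightarrow> real \<Rightarrow> ('a \<Rightarrow> complex) set" where
  "Lp_space M p = {f \<in> borel_measurable M. Lp_norm M p (\<lambda>x. ennreal (cmod (f x))) < \<infinity>}"

section \<open>Calderon--Zygmund sets and the sharp maximal function\<close>

definition CZ_sets :: "('a \<Rightarrow> 'a \<Rightarrow> bool) \<Rightarrow> 'a set \<Rightarrow> ('a \<Rightarrow> int) \<Rightarrow> 'a set set" where
  "CZ_sets E g N = {R. (\<exists>x. R = {x}) \<or>
    (\<exists>xR. \<exists>h::int. h \<ge> 1 \<and>
      R = {x. below E g N x xR \<and>
              real_of_int h / 2 \<le> real_of_int (level E g N xR - level E g N x) \<and>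
              level E g N xR - level E g N x < 4 * h})}"

definition average :: "'a measure \<Rightarrow> 'a set \<Rightarrow> ('a \<Rightarrow> complex) \<Rightarrow> complex" where
  "average M R f = complex_set_lebesgue_integral M R f / complex_of_real (measure M R)"

definition mean_oscillation :: "'a measure \<Rightarrow> real \<Rightarrow> 'a set \<Rightarrow> ('a \<Rightarrow> complex) \<Rightarrow> ennreal" where
  "mean_oscillation M q R f = ennreal_powr
    ((\<integral>\<^sup>+ y\<in>R. ennreal (cmod (f y - average M R f) powr q) \<partial>M) / emeasure M R) (1 / q)"

definition sharp_maximal :: "('a \<Rightarrow> 'a \<Rightarrow> bool) \<Rightarrow> nat \<Rightarrow> 'a set \<Rightarrow> ('a \<Rightarrow> int) \<Rightarrow>
    real \<Rightarrow> ('a \<Rightarrow> complex) \<Rightarrow> 'a \<Rightarrow> ennreal" where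
  "sharp_maximal E m g N q f x =
    (SUP R\<in>{R \<in> CZ_sets E g N. x \<in> R}. mean_oscillation (tree_measure E m g N) q R f)"

end

theory Submission
  imports Defs
begin

text \<open>
  Every vertex \<open>x\<close> has one neighbour one level up, its parent, and \<open>m\<close> neighbours one level down, and
  a vertex lies below \<open>x\<close> exactly if \<open>x\<close> is one of its iterated parents. The \<open>m ^ k\<close> vertices at depth
  \<open>k\<close> below \<open>x\<close> have measure \<open>m powi level x\<close> together, whatever \<open>k\<close> is. So the trapezoid of the vertices
  whose depth below \<open>x\<close> lies in \<open>[a, b)\<close> has measure \<open>(b - a) * m powi level x\<close>. Although balls grow
  exponentially, the trapezoids with \<open>2 * a \<le> b \<le> 8 * a\<close> therefore behave like dyadic cubes: each one
  can be cut, either into trapezoids below the children of its top or at depth \<open>2 * a\<close>, into finitely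
  many such trapezoids or points of comparable measure, down to single points. Moreover each one fills a
  fixed proportion of a Calderon--Zygmund set, the trapezoid with depths in \<open>[a, 8 * a)\<close>, so its mean
  oscillation is at most a constant times any value that the sharp function takes on it.

  On such a system of nested partitions the classical argument applies. Let \<open>M\<close> be the maximal function
  of \<open>f - c\<close>, where \<open>c\<close> is the mean of \<open>f\<close> over the top set \<open>Q\<close>. The cell
  directly above a maximal one whose mean is farther than \<open>t\<close> from \<open>c\<close> still has its mean within \<open>t\<close> of \<open>c\<close>,
  and the weak-type bound, applied relative to that mean, gives the good-lambda inequality
  \<open>t * \<mu> {M > 2 * t} \<le> K * (\<integral> over {M > t} of the sharp function)\<close> (lemma \<open>good_lambda\<close>). Multiplying by
  \<open>t powr (p - 2)\<close>, integrating over \<open>t\<close> and absorbing by Young's inequality bounds the \<open>L\<^sup>p\<close> norm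
  of \<open>f - c\<close> on \<open>Q\<close> (theorem \<open>nested_sharp_inequality\<close>). Since \<open>Q\<close> is finite, all quantities are finite
  and the absorption is legitimate without any a priori bound.

  Finally let \<open>Q\<close> run through trapezoids that exhaust the tree and whose measures tend to infinity. As \<open>f\<close>
  lies in \<open>L\<^sup>q\<close> for a finite exponent \<open>q\<close>, the means \<open>c\<close> tend to \<open>0\<close>, and Fatou's lemma gives the inequality for \<open>f\<close>
  (lemma \<open>integral_sharp_inequality\<close>).
\<close>

section \<open>Weighted means and nested partitions\<close>

definition weighted_mean :: "('a \<Rightarrow> real) \<Rightarrow> ('a \<Rightarrow> complex) \<Rightarrow> 'a set \<Rightarrow> complex" where
  "weighted_mean w f S = (\<Sum>x\<in>S. w x *\<^sub>R f x) /\<^sub>R sum w S"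

lemma weighted_sum_diff_const:
  assumes "sum w S > 0"
  shows "(\<Sum>x\<in>S. w x *\<^sub>R (f x - c)) = sum w S *\<^sub>R (weighted_mean w f S - c)"
proof -
  have "(\<Sum>x\<in>S. w x *\<^sub>R (f x - c)) = (\<Sum>x\<in>S. w x *\<^sub>R f x) - sum w S *\<^sub>R c"
    by (simp add: scaleR_diff_right sum_subtractf scaleR_left.sum)
  also have "(\<Sum>x\<in>S. w x *\<^sub>R f x) = sum w S *\<^sub>R weighted_mean w f S"
    using assms by (simp add: weighted_mean_def)
  finally show ?thesis by (simp add: scaleR_diff_right)
qed

lemma norm_weighted_mean_diff_le:
  assumes "\<And>x. w x > 0" "finite S" "S \<noteq> {}"
  shows "sum w S * cmod (weighted_mean w f S - c) \<le> (\<Sum>x\<in>S. w x * cmod (f x - c))"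
proof -
  have pos: "sum w S > 0" using assms by (simp add: sum_pos)
  have "sum w S * cmod (weighted_mean w f S - c) = cmod (\<Sum>x\<in>S. w x *\<^sub>R (f x - c))"
    using pos by (simp add: weighted_sum_diff_const)
  also have "\<dots> \<le> (\<Sum>x\<in>S. cmod (w x *\<^sub>R (f x - c)))" by (rule norm_sum)
  also have "\<dots> = (\<Sum>x\<in>S. w x * cmod (f x - c))"
    using assms(1) by (simp add: less_imp_le)
  finally show ?thesis .
qed

text \<open>The triangle inequality through \<open>c\<close> costs the distance from \<open>c\<close> to the mean, which is itself at most
  the mean distance of \<open>f\<close> from \<open>c\<close>. This passes from a set to a larger one of comparable weight without
  comparing the two means.\<close>

lemma mean_almost_minimizes_oscillation:
  assumes w: "\<And>x. w x > 0" and "finite S" "S \<noteq> {}"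
  shows "(\<Sum>x\<in>S. w x * cmod (f x - weighted_mean w f S)) \<le> 2 * (\<Sum>x\<in>S. w x * cmod (f x - c))"
proof -
  let ?c = "weighted_mean w f S"
  have "w x * cmod (f x - ?c) \<le> w x * cmod (f x - c) + w x * cmod (?c - c)" for x
    using norm_triangle_ineq4[of "f x - c" "?c - c"] w[of x]
    by (simp flip: distrib_left)
  then have "(\<Sum>x\<in>S. w x * cmod (f x - ?c)) \<le> (\<Sum>x\<in>S. w x * cmod (f x - c) + w x * cmod (?c - c))"
    by (intro sum_mono)
  also have "\<dots> = (\<Sum>x\<in>S. w x * cmod (f x - c)) + sum w S * cmod (?c - c)"
    by (simp add: sum.distrib sum_distrib_right)
  finally show ?thesis
    using norm_weighted_mean_diff_le[of w S f c] assms by simp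
qed

text \<open>Jensen's inequality up to a factor \<open>2\<close>, which allows an elementary proof by splitting at the height
  of the power mean.\<close>

lemma weighted_power_mean_bound:
  fixes w u :: "'a \<Rightarrow> real"
  assumes w: "\<And>x. w x > 0" and S: "finite S" "S \<noteq> {}" and u: "\<And>x. u x \<ge> 0" and q: "q > 1"
  shows "(\<Sum>x\<in>S. w x * u x) \<le> 2 * sum w S * ((\<Sum>x\<in>S. w x * u x powr q) / sum w S) powr (1/q)"
proof -
  define W where "W = sum w S"
  have W: "W > 0" unfolding W_def using w S by (intro sum_pos) auto
  define A where "A = (\<Sum>x\<in>S. w x * u x powr q)"
  have A: "A \<ge> 0" unfolding A_def by (intro sum_nonneg) (simp add: w less_imp_le)
  define T where "T = (A / W) powr (1/q)"
  show ?thesis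
  proof (cases "A = 0")
    case True
    have "\<forall>x\<in>S. w x * u x powr q = 0"
      using True S w unfolding A_def by (subst (asm) sum_nonneg_eq_0_iff) (simp_all add: less_imp_le)
    then have "\<forall>x\<in>S. u x = 0" using w by (metis less_numeral_extra(3) mult_eq_0_iff powr_eq_0_iff)
    then show ?thesis using W by (simp add: W_def)
  next
    case False
    then have T: "T > 0" using A W by (simp add: T_def)
    have Tq: "T powr q = A / W" using False A W q by (simp add: T_def powr_powr)
    \<comment> \<open>Where \<open>u x\<close> exceeds the power mean \<open>T\<close>, it is dominated by \<open>u x powr q * T powr (1 - q)\<close>.\<close>
    have split: "u x \<le> T + u x powr q * T powr (1 - q)" for x
    proof (cases "u x \<le> T")
      case True then show ?thesis by (simp add: add_increasing2)
    next
      case False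
      then have "u x = u x powr q * u x powr (1 - q)" using T by (simp flip: powr_add)
      also have "\<dots> \<le> u x powr q * T powr (1 - q)"
        using False T q by (intro mult_left_mono powr_mono2') auto
      finally show ?thesis using T by simp
    qed
    have "(\<Sum>x\<in>S. w x * u x) \<le> (\<Sum>x\<in>S. w x * (T + u x powr q * T powr (1 - q)))"
      by (intro sum_mono mult_left_mono split) (simp add: w less_imp_le)
    also have "\<dots> = W * T + A * T powr (1 - q)"
      by (simp add: W_def A_def sum.distrib distrib_left sum_distrib_right mult.assoc)
    also have "A * T powr (1 - q) = W * T"
      using W T Tq False by (simp add: powr_diff)
    finally show ?thesis by (simp add: W_def T_def A_def)
  qed
qed

text \<open>The finite counterpart of a regular filtration: \<open>D\<close> collects all cells obtained from \<open>Q\<close> by successive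
  partitioning down to points, and no partitioning step shrinks the weight by more than the factor \<open>\<kappa>\<close>.\<close>

inductive nested_partition :: "('a \<Rightarrow> real) \<Rightarrow> real \<Rightarrow> 'a set \<Rightarrow> 'a set set \<Rightarrow> bool"
  for w :: "'a \<Rightarrow> real" and \<kappa> :: real where
  point: "nested_partition w \<kappa> {x} {{x}}"
| split: "finite P \<Longrightarrow> P \<noteq> {} \<Longrightarrow> disjoint P \<Longrightarrow> (\<And>S. S \<in> P \<Longrightarrow> nested_partition w \<kappa> S (D S)) \<Longrightarrow>
    (\<And>S. S \<in> P \<Longrightarrow> sum w (\<Union>P) \<le> \<kappa> * sum w S) \<Longrightarrow>
    nested_partition w \<kappa> (\<Union>P) (insert (\<Union>P) (\<Union>S\<in>P. D S))"

text \<open>One partitioning step, with a property \<open>A\<close> carried along for all cells.\<close>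

lemma nested_partition_assemble:
  assumes "finite P" "P \<noteq> {}" "disjoint P" "A (\<Union>P)"
    and "\<And>S. S \<in> P \<Longrightarrow> \<exists>D. nested_partition w \<kappa> S D \<and> (\<forall>T\<in>D. A T)"
    and "\<And>S. S \<in> P \<Longrightarrow> sum w (\<Union>P) \<le> \<kappa> * sum w S"
  shows "\<exists>D. nested_partition w \<kappa> (\<Union>P) D \<and> (\<forall>T\<in>D. A T)"
proof -
  obtain D where D: "\<forall>S\<in>P. nested_partition w \<kappa> S (D S) \<and> (\<forall>T\<in>D S. A T)"
    using bchoice[of P "\<lambda>S D. nested_partition w \<kappa> S D \<and> (\<forall>T\<in>D. A T)"] assms(5) by blast
  then have "nested_partition w \<kappa> (\<Union>P) (insert (\<Union>P) (\<Union>S\<in>P. D S))"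
    using assms by (intro nested_partition.split) auto
  then show ?thesis using D assms(4) by blast
qed

text \<open>The set where the dyadic maximal function of \<open>f - c\<close> over the cells in \<open>D\<close> exceeds \<open>t\<close>.\<close>

definition superlevel :: "('a \<Rightarrow> real) \<Rightarrow> ('a \<Rightarrow> complex) \<Rightarrow> complex \<Rightarrow> real \<Rightarrow> 'a set set \<Rightarrow> 'a set" where
  "superlevel w f c t D = {x. \<exists>S\<in>D. x \<in> S \<and> t < cmod (weighted_mean w f S - c)}"

lemma nested_partition_basic:
  assumes "nested_partition w \<kappa> Q D"
  shows "finite Q \<and> Q \<noteq> {} \<and> Q \<in> D \<and> (\<forall>S\<in>D. S \<subseteq> Q) \<and> (\<forall>x\<in>Q. {x} \<in> D) \<and> finite D"
  using assms
proof induction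
  case (split P D)
  have "finite S" "S \<noteq> {}" "\<forall>T\<in>D S. T \<subseteq> S" "\<forall>x\<in>S. {x} \<in> D S" "finite (D S)" if "S \<in> P" for S
    using split.IH[OF that] by auto
  moreover from this have "\<Union>P \<noteq> {}" using split.hyps(2) by fastforce
  ultimately show ?case using split.hyps(1) by (intro conjI) (simp | blast)+
qed auto

lemma superlevel_insert:
  "superlevel w f c t (insert Q D) =
    (if t < cmod (weighted_mean w f Q - c) then Q else {}) \<union> superlevel w f c t D"
  by (auto simp: superlevel_def)

lemma superlevel_UN: "superlevel w f c t (\<Union>S\<in>P. D S) = (\<Union>S\<in>P. superlevel w f c t (D S))"
  by (auto simp: superlevel_def)

lemma superlevel_subset: "nested_partition w \<kappa> Q D \<Longrightarrow> superlevel w f c t D \<subseteq> Q"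
  using nested_partition_basic by (fastforce simp: superlevel_def)

lemma sum_superlevel_UN:
  assumes "finite P" "disjoint P" "\<And>S. S \<in> P \<Longrightarrow> nested_partition w \<kappa> S (D S)"
  shows "sum h (superlevel w f c t (\<Union>S\<in>P. D S)) = (\<Sum>S\<in>P. sum h (superlevel w f c t (D S)))"
  unfolding superlevel_UN
proof (intro sum.UNION_disjoint)
  show "\<forall>S\<in>P. finite (superlevel w f c t (D S))"
  proof
    fix S assume "S \<in> P"
    then show "finite (superlevel w f c t (D S))"
      using finite_subset[OF superlevel_subset] nested_partition_basic assms(3) by blast
  qed
  show "\<forall>S\<in>P. \<forall>T\<in>P. S \<noteq> T \<longrightarrow> superlevel w f c t (D S) \<inter> superlevel w f c t (D T) = {}"
  proof (intro ballI impI)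
    fix S T assume ST: "S \<in> P" "T \<in> P" "S \<noteq> T"
    then have "S \<inter> T = {}" using assms(2) by (auto simp: disjoint_def)
    then show "superlevel w f c t (D S) \<inter> superlevel w f c t (D T) = {}"
      using superlevel_subset[OF assms(3)[OF ST(1)]] superlevel_subset[OF assms(3)[OF ST(2)]] by blast
  qed
qed fact

lemma sum_Union_partition:
  assumes "finite P" "disjoint P" "\<And>S. S \<in> P \<Longrightarrow> finite S"
  shows "sum h (\<Union>P) = (\<Sum>S\<in>P. sum h S)"
  using assms by (subst sum.Union_disjoint) (auto simp: disjoint_def)

text \<open>Induction over the partition plays the role of selecting the maximal cells: either \<open>Q\<close> itself is
  selected, or the estimates for its parts add up.\<close>

lemma weak_type_maximal:
  assumes "nested_partition w \<kappa> Q D" and w: "\<And>x. w x > 0" and t: "t > 0"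
  shows "t * sum w (superlevel w f c t D) \<le> (\<Sum>x\<in>Q. w x * cmod (f x - c))"
  using assms(1)
proof (induction)
  case (point x)
  have "weighted_mean w f {x} = f x" using w[of x] by (simp add: weighted_mean_def)
  then have "superlevel w f c t {{x}} = (if t < cmod (f x - c) then {x} else {})"
    by (auto simp: superlevel_def)
  then show ?case using w[of x] by (simp add: mult.commute)
next
  case (split P D)
  have np: "nested_partition w \<kappa> (\<Union>P) (insert (\<Union>P) (\<Union>S\<in>P. D S))"
    using split by (intro nested_partition.split) auto
  show ?case
  proof (cases "t < cmod (weighted_mean w f (\<Union>P) - c)")
    case True
    have "superlevel w f c t (insert (\<Union>P) (\<Union>S\<in>P. D S)) = \<Union>P"
      using superlevel_subset[OF np, of f c t] True by (simp add: superlevel_insert Un_absorb2)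
    moreover have "t * sum w (\<Union>P) \<le> sum w (\<Union>P) * cmod (weighted_mean w f (\<Union>P) - c)"
    proof -
      have "sum w (\<Union>P) \<ge> 0" using w by (intro sum_nonneg less_imp_le)
      then show ?thesis using True by (simp add: mult.commute[of t] mult_left_mono)
    qed
    moreover have "\<dots> \<le> (\<Sum>x\<in>\<Union>P. w x * cmod (f x - c))"
      using nested_partition_basic[OF np] by (intro norm_weighted_mean_diff_le w) blast+
    ultimately show ?thesis by simp
  next
    case False
    then have "t * sum w (superlevel w f c t (insert (\<Union>P) (\<Union>S\<in>P. D S)))
        = (\<Sum>S\<in>P. t * sum w (superlevel w f c t (D S)))"
      using split.hyps(1-4) sum_superlevel_UN[of P w \<kappa> D]
      by (simp add: superlevel_insert sum_distrib_left)
    also have "\<dots> \<le> (\<Sum>S\<in>P. (\<Sum>x\<in>S. w x * cmod (f x - c)))"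
      using split.IH by (intro sum_mono)
    also have "\<dots> = (\<Sum>x\<in>\<Union>P. w x * cmod (f x - c))"
    proof (intro sum_Union_partition[symmetric] split.hyps(1,3))
      show "finite S" if "S \<in> P" for S
        using nested_partition_basic[OF split.hyps(4)[OF that]] by simp
    qed
    finally show ?thesis .
  qed
qed

text \<open>The recursion descends as long as the means stay within \<open>t\<close> of \<open>c\<close>. At the first cell \<open>S\<close> where this
  fails, all of \<open>S\<close> belongs to the lower superlevel set. The enclosing cell has a mean within \<open>t\<close> of \<open>c\<close>, so
  exceeding \<open>2 * t\<close> relative to \<open>c\<close> forces exceeding \<open>t\<close> relative to that mean, and the weak-type bound turns this into the
  oscillation over the enclosing cell, whose weight is comparable to that of \<open>S\<close>.\<close>

lemma good_lambda:
  assumes "nested_partition w \<kappa> Q D" and w: "\<And>x. w x > 0" and t: "t > 0"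
    and K: "K \<ge> 0" and \<kappa>: "\<kappa> \<ge> 0" and \<gamma>: "\<And>x. \<gamma> x \<ge> 0"
    and "\<And>S x. S \<in> D \<Longrightarrow> x \<in> S \<Longrightarrow>
      (\<Sum>y\<in>S. w y * cmod (f y - weighted_mean w f S)) \<le> K * sum w S * \<gamma> x"
    and "cmod (weighted_mean w f Q - c) \<le> t"
  shows "t * sum w (superlevel w f c (2 * t) D)
    \<le> \<kappa> * K * (\<Sum>x\<in>superlevel w f c t D. w x * \<gamma> x)"
  using assms(1,7,8)
proof (induction)
  case (point x)
  have "\<not> 2 * t < cmod (weighted_mean w f {x} - c)" using point(2) t by linarith
  then have "superlevel w f c (2*t) {{x}} = {}" by (simp add: superlevel_def)
  then show ?case using K \<kappa> \<gamma> w by (simp add: sum_nonneg less_imp_le)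
next
  case (split P D)
  let ?Q = "\<Union>P"
  have fin: "finite S" "S \<noteq> {}" if "S \<in> P" for S
    using nested_partition_basic[OF split.hyps(4)[OF that]] by auto
  have Q: "finite ?Q" using fin split by auto
  have osc: "(\<Sum>y\<in>S. w y * cmod (f y - weighted_mean w f S)) \<le> K * sum w S * \<gamma> x"
    if "T \<in> P" "S \<in> D T" "x \<in> S" for S T x
    using that by (intro split.prems(1)) auto
  have oscQ: "(\<Sum>y\<in>?Q. w y * cmod (f y - weighted_mean w f ?Q)) \<le> K * sum w ?Q * \<gamma> x"
    if "x \<in> ?Q" for x
    using split.prems(1)[of ?Q x] that by simp
  have child: "t * sum w (superlevel w f c (2 * t) (D S))
      \<le> \<kappa> * K * (\<Sum>x\<in>superlevel w f c t (D S). w x * \<gamma> x)" if S: "S \<in> P" for S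
  proof (cases "cmod (weighted_mean w f S - c) \<le> t")
    case True
    then show ?thesis using split.IH[OF S] osc[OF S] by simp
  next
    case False
    have npS: "nested_partition w \<kappa> S (D S)" using split.hyps(4) S .
    have all: "superlevel w f c t (D S) = S"
    proof
      show "superlevel w f c t (D S) \<subseteq> S" by (rule superlevel_subset[OF npS])
      have "S \<in> D S" using nested_partition_basic[OF npS] by blast
      then show "S \<subseteq> superlevel w f c t (D S)" using False by (auto simp: superlevel_def)
    qed
    define a where "a = weighted_mean w f ?Q"
    have "superlevel w f c (2 * t) (D S) \<subseteq> superlevel w f a t (D S)"
    proof (clarsimp simp: superlevel_def)
      fix x R assume R: "R \<in> D S" "x \<in> R" "2 * t < cmod (weighted_mean w f R - c)"
      have "cmod (weighted_mean w f R - c) \<le> cmod (weighted_mean w f R - a) + cmod (a - c)"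
        using norm_triangle_ineq[of "weighted_mean w f R - a" "a - c"] by simp
      then have "t < cmod (weighted_mean w f R - a)"
        using R split.prems(2) by (simp add: a_def)
      then show "\<exists>S\<in>D S. x \<in> S \<and> t < cmod (weighted_mean w f S - a)" using R by blast
    qed
    then have "t * sum w (superlevel w f c (2 * t) (D S)) \<le> t * sum w (superlevel w f a t (D S))"
      using t w finite_subset[OF superlevel_subset[OF npS] fin(1)[OF S]]
      by (intro mult_left_mono sum_mono2) (auto simp: less_imp_le)
    also have "\<dots> \<le> (\<Sum>x\<in>S. w x * cmod (f x - a))"
      using npS w t by (rule weak_type_maximal)
    also have "\<dots> \<le> (\<Sum>x\<in>?Q. w x * cmod (f x - a))"
      using S Q w by (intro sum_mono2) (auto simp: less_imp_le)
    finally have bound: "t * sum w (superlevel w f c (2 * t) (D S)) \<le> (\<Sum>x\<in>?Q. w x * cmod (f x - a))" (is "?L \<le> ?R") .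
    have pos: "sum w S > 0" using fin[OF S] w by (simp add: sum_pos)
    \<comment> \<open>The oscillation over \<open>?Q\<close> is controlled by the value of \<open>\<gamma>\<close> at every point of \<open>S\<close>, hence by its
      mean over \<open>S\<close>.\<close>
    have "sum w S * ?L = (\<Sum>x\<in>S. w x * ?L)" by (simp add: sum_distrib_right)
    also have "\<dots> \<le> (\<Sum>x\<in>S. w x * (\<kappa> * K * sum w S * \<gamma> x))"
    proof (intro sum_mono mult_left_mono)
      fix x assume x: "x \<in> S"
      have "?L \<le> K * sum w ?Q * \<gamma> x" using bound oscQ[of x] S x unfolding a_def by (meson UnionI order_trans)
      also have "\<dots> \<le> K * (\<kappa> * sum w S) * \<gamma> x"
        using split.hyps(5)[OF S] K \<gamma> by (intro mult_right_mono mult_left_mono) auto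
      finally show "?L \<le> \<kappa> * K * sum w S * \<gamma> x" by (simp add: mult_ac)
    qed (simp add: w less_imp_le)
    also have "\<dots> = sum w S * (\<kappa> * K * (\<Sum>x\<in>S. w x * \<gamma> x))"
      by (simp add: sum_distrib_left mult_ac)
    finally show ?thesis using pos all by simp
  qed
  have nosplit: "\<not> 2 * t < cmod (weighted_mean w f ?Q - c)" "\<not> t < cmod (weighted_mean w f ?Q - c)"
    using split.prems(2) t by auto
  then have "t * sum w (superlevel w f c (2 * t) (insert ?Q (\<Union>S\<in>P. D S)))
      = (\<Sum>S\<in>P. t * sum w (superlevel w f c (2 * t) (D S)))"
    using split.hyps sum_superlevel_UN[of P w \<kappa> D] by (simp add: superlevel_insert sum_distrib_left)
  also have "\<dots> \<le> (\<Sum>S\<in>P. \<kappa> * K * (\<Sum>x\<in>superlevel w f c t (D S). w x * \<gamma> x))"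
    by (intro sum_mono child)
  also have "\<dots> = \<kappa> * K * (\<Sum>x\<in>superlevel w f c t (insert ?Q (\<Union>S\<in>P. D S)). w x * \<gamma> x)"
    using split.hyps(1-4) sum_superlevel_UN[of P w \<kappa> D "\<lambda>x. w x * \<gamma> x" f c t] nosplit
    by (simp only: superlevel_insert if_False Un_empty_left flip: sum_distrib_left)
  finally show ?case .
qed

lemma nn_integral_powr_interval:
  assumes "a > -1" "c \<ge> 0"
  shows "(\<integral>\<^sup>+t. ennreal (t powr a * indicator {0<..<c} t) \<partial>lborel) = ennreal (c powr (a + 1) / (a + 1))"
proof -
  have "(\<integral>\<^sup>+t. ennreal (t powr a) * indicator {0..c} t \<partial>lborel) = ennreal (c powr (a + 1) / (a + 1))"
    using assms by (intro nn_integral_has_integral_lebesgue' has_integral_powr_from_0) auto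
  moreover have "(\<integral>\<^sup>+t. ennreal (t powr a * indicator {0<..<c} t) \<partial>lborel)
      = (\<integral>\<^sup>+t. ennreal (t powr a) * indicator {0..c} t \<partial>lborel)"
  proof (intro nn_integral_cong_AE)
    have "AE t in lborel. t \<noteq> (0::real) \<and> t \<noteq> c"
      by (intro AE_conjI AE_lborel_singleton)
    then show "AE t in lborel. ennreal (t powr a * indicator {0<..<c} t) = ennreal (t powr a) * indicator {0..c} t"
      by eventually_elim (auto simp: indicator_def)
  qed
  ultimately show ?thesis by simp
qed

text \<open>Young's inequality with a small parameter; comparing \<open>a\<close> with \<open>\<eta> * b\<close> replaces the sharp constants.\<close>

lemma young_absorb:
  fixes a b \<eta> p :: real
  assumes "a \<ge> 0" "b \<ge> 0" "\<eta> > 0" "p > 1"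
  shows "a * b powr (p - 1) \<le> \<eta> * b powr p + \<eta> powr (1 - p) * a powr p"
proof (cases "a \<le> \<eta> * b")
  case True
  have "a * b powr (p - 1) \<le> \<eta> * b * b powr (p - 1)" using True by (intro mult_right_mono) auto
  also have "\<dots> = \<eta> * b powr p"
    using assms by (cases "b = 0") (simp_all add: powr_diff)
  finally show ?thesis by (simp add: add_increasing2)
next
  case False
  then have "b \<le> a / \<eta>" "a > 0" using assms by (auto simp: field_simps intro: le_less_trans[of 0 "\<eta> * b"])
  then have "a * b powr (p - 1) \<le> a * (a / \<eta>) powr (p - 1)"
    using assms by (intro mult_left_mono powr_mono2) auto
  also have "\<dots> = \<eta> powr (1 - p) * a powr p"
    using assms \<open>a > 0\<close> by (simp add: powr_divide powr_diff)
  finally show ?thesis using assms by (simp add: add_increasing)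
qed

text \<open>The constant left by integrating a good-lambda inequality with factor \<open>K\<close> and absorbing half of the result.\<close>

definition sharp_constant :: "real \<Rightarrow> real \<Rightarrow> real" where
  "sharp_constant K p = (let B = K * p / (p - 1) * 2 powr p in 2 * B * (2 * B) powr (p - 1))"

lemma sharp_constant_pos: "K > 0 \<Longrightarrow> p > 1 \<Longrightarrow> sharp_constant K p > 0"
  by (simp add: sharp_constant_def Let_def)

text \<open>Integrating the hypothesis against \<open>t powr (p - 2)\<close> over \<open>t > 0\<close> gives, by Tonelli, an estimate of
  \<open>M powr p\<close> by \<open>\<gamma> * M powr (p - 1)\<close>; half of the left-hand side is then absorbed.\<close>

lemma Lp_bound_from_good_lambda:
  fixes w M \<gamma> :: "'a \<Rightarrow> real"
  assumes X: "finite X" and w: "\<And>x. w x \<ge> 0" and M: "\<And>x. M x \<ge> 0" and \<gamma>: "\<And>x. \<gamma> x \<ge> 0"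
    and K: "K > 0" and p: "p > 1"
    and gl: "\<And>t. t > 0 \<Longrightarrow>
      t * sum w {x \<in> X. 2 * t < M x} \<le> K * (\<Sum>x\<in>{x \<in> X. t < M x}. w x * \<gamma> x)"
  shows "(\<Sum>x\<in>X. w x * M x powr p) \<le> sharp_constant K p * (\<Sum>x\<in>X. w x * \<gamma> x powr p)"
proof -
  define B where "B = K * p / (p - 1) * 2 powr p"
  have B: "B > 0" unfolding B_def using K p by simp
  \<comment> \<open>The hypothesis multiplied by \<open>t powr (p - 2)\<close>, with the level sets written as indicators of intervals in \<open>t\<close>.\<close>
  have pt: "(\<Sum>x\<in>X. w x * (t powr (p - 1) * indicator {0<..<M x / 2} t))
      \<le> (\<Sum>x\<in>X. K * w x * \<gamma> x * (t powr (p - 2) * indicator {0<..<M x} t))" for t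
  proof (cases "t > 0")
    case True
    have "(\<Sum>x\<in>X. w x * (t powr (p - 1) * indicator {0<..<M x / 2} t))
        = t powr (p - 2) * (t * sum w {x \<in> X. 2 * t < M x})"
    proof -
      have "t powr (p - 1) = t powr (p - 2) * t" 
        using True powr_mult_base[of t "p - 2"] by (simp add: algebra_simps)
      moreover have "sum w {x \<in> X. 2 * t < M x} = (\<Sum>x\<in>X. w x * indicator {0<..<M x / 2} t)"
        unfolding sum.inter_filter[OF X] using True
        by (intro sum.cong refl) (auto simp: indicator_def field_simps)
      ultimately show ?thesis by (simp add: sum_distrib_left mult_ac)
    qed
    also have "\<dots> \<le> t powr (p - 2) * (K * (\<Sum>x\<in>{x \<in> X. t < M x}. w x * \<gamma> x))"
      using gl[OF True] by (intro mult_left_mono) auto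
    also have "(\<Sum>x\<in>{x \<in> X. t < M x}. w x * \<gamma> x) = (\<Sum>x\<in>X. w x * \<gamma> x * indicator {0<..<M x} t)"
      unfolding sum.inter_filter[OF X] using True
      by (intro sum.cong refl) (auto simp: indicator_def)
    finally show ?thesis by (simp add: sum_distrib_left mult_ac)
  qed simp
  have L: "(\<integral>\<^sup>+t. ennreal (\<Sum>x\<in>X. w x * (t powr (p - 1) * indicator {0<..<M x / 2} t)) \<partial>lborel)
      = ennreal (\<Sum>x\<in>X. w x * ((M x / 2) powr p / p))"
  proof -
    have "(\<integral>\<^sup>+t. ennreal (\<Sum>x\<in>X. w x * (t powr (p - 1) * indicator {0<..<M x / 2} t)) \<partial>lborel)
        = (\<integral>\<^sup>+t. (\<Sum>x\<in>X. ennreal (w x) * ennreal (t powr (p - 1) * indicator {0<..<M x / 2} t)) \<partial>lborel)"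
      using w by (intro nn_integral_cong) (simp add: ennreal_mult flip: sum_ennreal)
    also have "\<dots> = (\<Sum>x\<in>X. ennreal (w x) * (\<integral>\<^sup>+t. ennreal (t powr (p - 1) * indicator {0<..<M x / 2} t) \<partial>lborel))"
      by (simp add: nn_integral_sum nn_integral_cmult)
    also have "\<dots> = (\<Sum>x\<in>X. ennreal (w x) * ennreal ((M x / 2) powr p / p))"
      using p M by (subst nn_integral_powr_interval) auto
    also have "\<dots> = ennreal (\<Sum>x\<in>X. w x * ((M x / 2) powr p / p))"
      using w p by (simp add: sum_nonneg flip: sum_ennreal ennreal_mult)
    finally show ?thesis .
  qed
  have R: "(\<integral>\<^sup>+t. ennreal (\<Sum>x\<in>X. K * w x * \<gamma> x * (t powr (p - 2) * indicator {0<..<M x} t)) \<partial>lborel)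
      = ennreal (\<Sum>x\<in>X. K * w x * \<gamma> x * (M x powr (p - 1) / (p - 1)))"
  proof -
    have "(\<integral>\<^sup>+t. ennreal (\<Sum>x\<in>X. K * w x * \<gamma> x * (t powr (p - 2) * indicator {0<..<M x} t)) \<partial>lborel)
        = (\<integral>\<^sup>+t. (\<Sum>x\<in>X. ennreal (K * w x * \<gamma> x) * ennreal (t powr (p - 2) * indicator {0<..<M x} t)) \<partial>lborel)"
      using w K \<gamma> by (intro nn_integral_cong) (simp add: ennreal_mult flip: sum_ennreal)
    also have "\<dots> = (\<Sum>x\<in>X. ennreal (K * w x * \<gamma> x) * (\<integral>\<^sup>+t. ennreal (t powr (p - 2) * indicator {0<..<M x} t) \<partial>lborel))"
      by (simp add: nn_integral_sum nn_integral_cmult)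
    also have "\<dots> = (\<Sum>x\<in>X. ennreal (K * w x * \<gamma> x) * ennreal (M x powr (p - 1) / (p - 1)))"
      using p M by (subst nn_integral_powr_interval) auto
    also have "\<dots> = ennreal (\<Sum>x\<in>X. K * w x * \<gamma> x * (M x powr (p - 1) / (p - 1)))"
      using w p K \<gamma> by (simp add: sum_nonneg flip: sum_ennreal ennreal_mult)
    finally show ?thesis .
  qed
  have "ennreal (\<Sum>x\<in>X. w x * ((M x / 2) powr p / p))
      \<le> ennreal (\<Sum>x\<in>X. K * w x * \<gamma> x * (M x powr (p - 1) / (p - 1)))"
    unfolding L[symmetric] R[symmetric] by (intro nn_integral_mono ennreal_leI pt)
  then have "(\<Sum>x\<in>X. w x * ((M x / 2) powr p / p)) \<le> (\<Sum>x\<in>X. K * w x * \<gamma> x * (M x powr (p - 1) / (p - 1)))"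
    using w K \<gamma> p by (subst (asm) ennreal_le_iff) (auto intro!: sum_nonneg)
  also have "(\<Sum>x\<in>X. w x * ((M x / 2) powr p / p)) = (\<Sum>x\<in>X. w x * M x powr p) / (2 powr p * p)"
    using M by (simp add: powr_divide sum_divide_distrib)
  also have "(\<Sum>x\<in>X. K * w x * \<gamma> x * (M x powr (p - 1) / (p - 1)))
      = K / (p - 1) * (\<Sum>x\<in>X. w x * (\<gamma> x * M x powr (p - 1)))"
    by (simp add: sum_distrib_left mult_ac)
  finally have "(\<Sum>x\<in>X. w x * M x powr p) \<le> B * (\<Sum>x\<in>X. w x * (\<gamma> x * M x powr (p - 1)))"
    using p by (simp add: B_def field_simps)
  \<comment> \<open>The parameter \<open>1 / (2 * B)\<close> makes the first term half of the left-hand side.\<close>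
  also have "\<dots> \<le> B * (\<Sum>x\<in>X. w x * (1 / (2 * B) * M x powr p + (1 / (2 * B)) powr (1 - p) * \<gamma> x powr p))"
    using B w by (intro mult_left_mono sum_mono young_absorb \<gamma> M p) auto
  also have "\<dots> = (\<Sum>x\<in>X. w x * M x powr p) / 2 + B * (1 / (2 * B)) powr (1 - p) * (\<Sum>x\<in>X. w x * \<gamma> x powr p)"
  proof -
    have "(\<Sum>x\<in>X. w x * (1 / (2 * B) * M x powr p + a * \<gamma> x powr p))
        = 1 / (2 * B) * (\<Sum>x\<in>X. w x * M x powr p) + a * (\<Sum>x\<in>X. w x * \<gamma> x powr p)" for a
      unfolding distrib_left sum.distrib sum_distrib_left by (simp add: mult_ac)
    then show ?thesis using B by (simp add: distrib_left)
  qed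
  also have "(1 / (2 * B)) powr (1 - p) = (2 * B) powr (p - 1)"
    using B by (simp add: powr_divide powr_diff)
  finally show ?thesis by (simp add: sharp_constant_def B_def Let_def)
qed

text \<open>The good-lambda inequality for the maximal function centred at the mean of \<open>f\<close> over \<open>Q\<close>, which
  dominates \<open>\<bar>f - c\<bar>\<close> because the points are cells themselves.\<close>

theorem nested_sharp_inequality:
  fixes f :: "'a \<Rightarrow> complex"
  assumes np: "nested_partition w \<kappa> Q D" and w: "\<And>x. w x > 0" and \<gamma>: "\<And>x. \<gamma> x \<ge> 0"
    and K: "K > 0" and \<kappa>: "\<kappa> > 0" and p: "p > 1"
    and osc: "\<And>S x. S \<in> D \<Longrightarrow> x \<in> S \<Longrightarrow>
      (\<Sum>y\<in>S. w y * cmod (f y - weighted_mean w f S)) \<le> K * sum w S * \<gamma> x"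
  shows "(\<Sum>x\<in>Q. w x * cmod (f x - weighted_mean w f Q) powr p)
    \<le> sharp_constant (\<kappa> * K) p * (\<Sum>x\<in>Q. w x * \<gamma> x powr p)"
proof -
  define c where "c = weighted_mean w f Q"
  \<comment> \<open>Inserting \<open>0\<close> keeps the maximum meaningful outside \<open>Q\<close>, where no cell contains \<open>x\<close>.\<close>
  define V where "V x = insert 0 ((\<lambda>S. cmod (weighted_mean w f S - c)) ` {S \<in> D. x \<in> S})" for x
  define M where "M x = Max (V x)" for x
  have basic: "finite Q" "finite D" "\<And>x. x \<in> Q \<Longrightarrow> {x} \<in> D"
    using nested_partition_basic[OF np] by auto
  have V: "finite (V x)" "V x \<noteq> {}" for x using basic by (auto simp: V_def)
  have super: "superlevel w f c t D = {x \<in> Q. t < M x}" if "t > 0" for t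
    using V superlevel_subset[OF np, of f c t] that
    by (fastforce simp: M_def Max_gr_iff V_def superlevel_def)
  have M0: "M x \<ge> 0" for x unfolding M_def using V[of x] by (auto simp: V_def Max_ge_iff)
  have fM: "cmod (f x - c) \<le> M x" if "x \<in> Q" for x
  proof -
    have "weighted_mean w f {x} = f x" using w[of x] by (simp add: weighted_mean_def)
    then have "cmod (f x - c) \<in> V x" using basic(3)[OF that] by (force simp: V_def)
    then show ?thesis unfolding M_def using V by simp
  qed
  have "(\<Sum>x\<in>Q. w x * cmod (f x - c) powr p) \<le> (\<Sum>x\<in>Q. w x * M x powr p)"
    using fM p w by (intro sum_mono mult_left_mono powr_mono2) (auto simp: less_imp_le)
  also have "\<dots> \<le> sharp_constant (\<kappa> * K) p * (\<Sum>x\<in>Q. w x * \<gamma> x powr p)"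
  proof (intro Lp_bound_from_good_lambda)
    fix t :: real assume t: "t > 0"
    have "cmod (weighted_mean w f Q - c) \<le> t" using t by (simp add: c_def)
    then have "t * sum w (superlevel w f c (2 * t) D)
        \<le> \<kappa> * K * (\<Sum>x\<in>superlevel w f c t D. w x * \<gamma> x)"
      using np w t K \<kappa> \<gamma> osc by (intro good_lambda) auto
    then show "t * sum w {x \<in> Q. 2 * t < M x} \<le> \<kappa> * K * (\<Sum>x\<in>{x \<in> Q. t < M x}. w x * \<gamma> x)"
      using super t by simp
  qed (use basic w M0 \<gamma> K \<kappa> p in \<open>auto simp: less_imp_le\<close>)
  finally show ?thesis by (simp add: c_def)
qed

section \<open>Trapezoids\<close>

text \<open>A tree oriented towards a point at infinity, given only by its parent map and its level function. The existence of common
  ancestors expresses connectedness.\<close>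

locale rooted_at_infinity =
  fixes parent :: "'a \<Rightarrow> 'a" and lev :: "'a \<Rightarrow> int" and m :: nat
  assumes m_pos: "m \<ge> 1"
    and lev_parent: "lev (parent x) = lev x + 1"
    and card_children: "card {y. parent y = x} = m"
    and common_ancestor: "\<exists>i j. (parent ^^ i) x = (parent ^^ j) y"
begin

definition wt :: "'a \<Rightarrow> real" where "wt x = real m powi lev x"

text \<open>Short for trapezoid, the usual name of these sets.\<close>

definition trap :: "'a \<Rightarrow> nat \<Rightarrow> nat \<Rightarrow> 'a set" where
  "trap x a b = {y. \<exists>k. a \<le> k \<and> k < b \<and> (parent ^^ k) y = x}"

definition admissible :: "'a set \<Rightarrow> bool" where
  "admissible S \<longleftrightarrow> (\<exists>x. S = {x}) \<or> (\<exists>x a b. 1 \<le> a \<and> 2 * a \<le> b \<and> b \<le> 8 * a \<and> S = trap x a b)"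

lemma wt_pos: "wt x > 0"
  using m_pos by (simp add: wt_def)

lemma lev_iter: "lev ((parent ^^ k) x) = lev x + int k"
  by (induction k) (simp_all add: lev_parent)

lemma depth_unique: "(parent ^^ k) y = x \<Longrightarrow> (parent ^^ l) y = z \<Longrightarrow> lev x = lev z \<Longrightarrow> k = l"
  using lev_iter[of k y] lev_iter[of l y] by simp

lemma wt_parent: "wt (parent x) = real m * wt x"
  using m_pos by (simp add: wt_def lev_parent power_int_add)

lemma wt_iter: "wt ((parent ^^ k) x) = real m ^ k * wt x"
  by (induction k) (simp_all add: wt_parent)

lemma finite_children: "finite {y. parent y = x}"
  using card_children[of x] m_pos by (metis card.infinite not_one_le_zero)

lemma layer_Suc: "{y. (parent ^^ Suc k) y = x} = (\<Union>z\<in>{z. parent z = x}. {y. (parent ^^ k) y = z})"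
  by auto

text \<open>Passing to the children multiplies the number of vertices by \<open>m\<close> and divides their weight by \<open>m\<close>, so the
  weight of a layer does not depend on its depth.\<close>

lemma layer: "finite {y. (parent ^^ k) y = x}" "sum wt {y. (parent ^^ k) y = x} = wt x"
proof (induction k arbitrary: x)
  case (Suc k)
  {
    case 1
    show ?case unfolding layer_Suc using Suc finite_children by blast
  next
    case 2
    have "sum wt {y. (parent ^^ Suc k) y = x} = (\<Sum>z\<in>{z. parent z = x}. sum wt {y. (parent ^^ k) y = z})"
      unfolding layer_Suc using Suc finite_children by (intro sum.UNION_disjoint) auto
    also have "\<dots> = (\<Sum>z\<in>{z. parent z = x}. wt x / real m)"
      using Suc m_pos by (intro sum.cong) (auto simp: wt_parent)
    also have "\<dots> = wt x" using card_children[of x] m_pos by simp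
    finally show ?case .
  }
qed simp_all

lemma trap_layers: "trap x a b = (\<Union>k\<in>{a..<b}. {y. (parent ^^ k) y = x})"
  by (auto simp: trap_def)

lemma finite_trap: "finite (trap x a b)"
  unfolding trap_layers using layer by blast

lemma sum_wt_trap: "sum wt (trap x a b) = real (b - a) * wt x"
proof -
  have "sum wt (trap x a b) = (\<Sum>k\<in>{a..<b}. sum wt {y. (parent ^^ k) y = x})"
    unfolding trap_layers using layer by (intro sum.UNION_disjoint) (auto dest: depth_unique)
  also have "\<dots> = (\<Sum>k\<in>{a..<b}. wt x)" using layer by (intro sum.cong) auto
  finally show ?thesis by simp
qed

lemma trap_nonempty: "a < b \<Longrightarrow> trap x a b \<noteq> {}"
  using sum_wt_trap[of x a b] wt_pos[of x] by auto

lemma trap_children: "trap x (Suc a) (Suc b) = (\<Union>z\<in>{z. parent z = x}. trap z a b)"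
proof (intro equalityI subsetI)
  fix y assume "y \<in> trap x (Suc a) (Suc b)"
  then obtain k where k: "Suc a \<le> k" "k < Suc b" "(parent ^^ k) y = x" by (auto simp: trap_def)
  then obtain l where "k = Suc l" by (cases k) auto
  then show "y \<in> (\<Union>z\<in>{z. parent z = x}. trap z a b)" using k by (auto simp: trap_def)
next
  fix y assume "y \<in> (\<Union>z\<in>{z. parent z = x}. trap z a b)"
  then obtain k where "a \<le> k" "k < b" "parent ((parent ^^ k) y) = x" by (auto simp: trap_def)
  then show "y \<in> trap x (Suc a) (Suc b)"
    unfolding trap_def by (intro CollectI exI[of _ "Suc k"]) simp
qed

lemma trap_vertical: "a \<le> c \<Longrightarrow> c \<le> b \<Longrightarrow> trap x a b = trap x a c \<union> trap x c b"
  unfolding trap_layers by (simp flip: UN_Un add: ivl_disj_un_two(3))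

lemma trap_disjoint:
  assumes "lev x = lev z" "x \<noteq> z \<or> b \<le> c"
  shows "trap x a b \<inter> trap z c d = {}"
proof (rule ccontr)
  assume "trap x a b \<inter> trap z c d \<noteq> {}"
  then obtain y k l where y: "(parent ^^ k) y = x" "k < b" "(parent ^^ l) y = z" "c \<le> l"
    unfolding trap_def by blast
  moreover have "k = l" using y assms(1) by (intro depth_unique)
  ultimately show False using assms(2) by auto
qed

text \<open>While the ratio of the depths allows it, a trapezoid is cut horizontally into the trapezoids below the
  children of \<open>x\<close>, whose depths are smaller by one, so that \<open>b / a\<close> grows. Once \<open>b\<close> is too close to
  \<open>8 * a\<close> it is cut vertically at depth \<open>2 * a\<close>. With \<open>a = 1\<close> there are at most seven layers left, and the trapezoid is
  split into points at the price of the factor \<open>7 * real m ^ 7\<close>. The quantity \<open>2 * b - a\<close> decreases in both kinds of cuts.\<close>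

lemma trap_nested_partition:
  assumes "1 \<le> a" "2 * a \<le> b" "b \<le> 8 * a"
  shows "\<exists>D. nested_partition wt (7 * real m ^ 7) (trap x a b) D \<and> (\<forall>S\<in>D. admissible S)"
  using assms
proof (induction "2 * b - a" arbitrary: x a b rule: less_induct)
  case less
  let ?\<kappa> = "7 * real m ^ 7"
  have pow: "real m ^ k \<le> real m ^ 7" if "k \<le> 7" for k
    using m_pos that by (intro power_increasing) auto
  have m1: "1 \<le> real m ^ 7" "real m \<le> real m ^ 7" using pow[of 0] pow[of 1] by auto
  have adm: "admissible (trap x a b)" using less.prems by (auto simp: admissible_def)
  have IH: "\<exists>D. nested_partition wt ?\<kappa> (trap y c d) D \<and> (\<forall>S\<in>D. admissible S)"
    if "2 * d - c < 2 * b - a" "1 \<le> c" "2 * c \<le> d" "d \<le> 8 * c" for y c d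
    using less.hyps that .
  consider "a = 1" | "a \<ge> 2" "b \<le> 8 * a - 7" | "a \<ge> 2" "b > 8 * a - 7"
    using less.prems by linarith
  then show ?case
  proof cases
    case 1
    let ?P = "(\<lambda>y. {y}) ` trap x a b"
    have U: "\<Union>?P = trap x a b" by auto
    have "\<exists>D. nested_partition wt ?\<kappa> (\<Union>?P) D \<and> (\<forall>S\<in>D. admissible S)"
    proof (rule nested_partition_assemble)
      show "finite ?P" "?P \<noteq> {}" using finite_trap trap_nonempty less.prems by auto
      show "disjoint ?P" by (auto simp: disjoint_def)
      show "admissible (\<Union>?P)" using adm U by simp
      fix S assume "S \<in> ?P"
      then obtain y k where S: "S = {y}" "k < b" "(parent ^^ k) y = x" by (auto simp: trap_def)
      show "\<exists>D. nested_partition wt ?\<kappa> S D \<and> (\<forall>S\<in>D. admissible S)"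
        using nested_partition.point[of wt ?\<kappa> y] S by (intro exI[of _ "{{y}}"]) (auto simp: admissible_def)
      have "real (b - a) * wt x \<le> 7 * wt x" using 1 less.prems wt_pos[of x] by (intro mult_right_mono) auto
      also have "\<dots> \<le> 7 * (real m ^ 7 * wt y)"
        using wt_iter[of k y] S pow[of k] 1 less.prems wt_pos[of y] by simp
      finally show "sum wt (\<Union>?P) \<le> ?\<kappa> * sum wt S" unfolding U sum_wt_trap S(1) by simp
    qed
    then show ?thesis unfolding U .
  next
    case 2
    obtain c d where cd: "a = Suc c" "b = Suc d" using less.prems by (metis Suc_le_D One_nat_def add_leE mult_2)
    let ?P = "(\<lambda>z. trap z c d) ` {z. parent z = x}"
    have U: "\<Union>?P = trap x a b" by (simp add: cd trap_children)
    have "\<exists>D. nested_partition wt ?\<kappa> (\<Union>?P) D \<and> (\<forall>S\<in>D. admissible S)"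
    proof (rule nested_partition_assemble)
      show "finite ?P" using finite_children by blast
      have "{z. parent z = x} \<noteq> {}" using card_children[of x] m_pos by (metis card.empty not_one_le_zero)
      then show "?P \<noteq> {}" by blast
      have levs: "lev z = lev z'" if "parent z = x" "parent z' = x" for z z'
        using lev_parent[of z] lev_parent[of z'] that by simp
      show "disjoint ?P" using trap_disjoint levs unfolding disjoint_def by blast
      show "admissible (\<Union>?P)" using adm U by simp
      fix S assume "S \<in> ?P"
      then obtain z where S: "S = trap z c d" "parent z = x" by blast
      show "\<exists>D. nested_partition wt ?\<kappa> S D \<and> (\<forall>S\<in>D. admissible S)"
        unfolding S(1) using 2 less.prems cd by (intro IH) auto
      have "real (b - a) * wt x = real m * sum wt S"
        using S wt_parent[of z] by (simp add: sum_wt_trap cd)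
      also have "\<dots> \<le> ?\<kappa> * sum wt S"
        using m1 by (intro mult_right_mono sum_nonneg less_imp_le[OF wt_pos]) linarith
      finally show "sum wt (\<Union>?P) \<le> ?\<kappa> * sum wt S" unfolding U sum_wt_trap[of x] .
    qed
    then show ?thesis unfolding U .
  next
    case 3
    let ?P = "{trap x a (2 * a), trap x (2 * a) b}"
    have U: "\<Union>?P = trap x a b" using less.prems trap_vertical[of a "2 * a" b x] by simp
    have "\<exists>D. nested_partition wt ?\<kappa> (\<Union>?P) D \<and> (\<forall>S\<in>D. admissible S)"
    proof (rule nested_partition_assemble)
      show "disjoint ?P" using trap_disjoint[of x x "2 * a" "2 * a" a b] by (auto simp: disjoint_def)
      show "admissible (\<Union>?P)" using adm U by simp
      fix S assume S: "S \<in> ?P"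
      have "\<exists>D. nested_partition wt ?\<kappa> (trap x a (2 * a)) D \<and> (\<forall>S\<in>D. admissible S)"
        using 3 less.prems by (intro IH) auto
      moreover have "\<exists>D. nested_partition wt ?\<kappa> (trap x (2 * a) b) D \<and> (\<forall>S\<in>D. admissible S)"
        using 3 less.prems by (intro IH) auto
      ultimately show "\<exists>D. nested_partition wt ?\<kappa> S D \<and> (\<forall>S\<in>D. admissible S)"
        using S by auto
      have "real a * wt x \<le> sum wt S"
        using S 3 less.prems wt_pos[of x] by (auto simp: sum_wt_trap intro!: mult_right_mono)
      moreover have "real (b - a) * wt x \<le> 7 * (real a * wt x)"
        using less.prems wt_pos[of x] by (simp add: of_nat_diff)
      moreover have "7 * sum wt S \<le> ?\<kappa> * sum wt S"
        using m1 by (intro mult_right_mono sum_nonneg) (auto simp: wt_pos less_imp_le)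
      ultimately show "sum wt (\<Union>?P) \<le> ?\<kappa> * sum wt S" unfolding U sum_wt_trap[of x] by linarith
    qed auto
    then show ?thesis unfolding U .
  qed
qed

text \<open>A cell with depths in \<open>[c, d)\<close> sits in the trapezoid with depths in \<open>[c, 8 * c)\<close>, whose weight is at most \<open>7\<close> times as
  large because \<open>d - c \<ge> c\<close>. So oscillation bounds on the latter family suffice.\<close>

lemma trap_sharp_inequality:
  fixes f :: "'a \<Rightarrow> complex" and \<gamma> :: "'a \<Rightarrow> real"
  assumes p: "p > 1" and \<gamma>: "\<And>x. \<gamma> x \<ge> 0"
    and osc: "\<And>x a y. 1 \<le> a \<Longrightarrow> y \<in> trap x a (8 * a) \<Longrightarrow>
      (\<Sum>z\<in>trap x a (8 * a). wt z * cmod (f z - weighted_mean wt f (trap x a (8 * a))))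
        \<le> 2 * sum wt (trap x a (8 * a)) * \<gamma> y"
    and ab: "1 \<le> a" "2 * a \<le> b" "b \<le> 8 * a"
  shows "(\<Sum>y\<in>trap x a b. wt y * cmod (f y - weighted_mean wt f (trap x a b)) powr p)
    \<le> sharp_constant (196 * real m ^ 7) p * (\<Sum>y\<in>trap x a b. wt y * \<gamma> y powr p)"
proof -
  obtain D where D: "nested_partition wt (7 * real m ^ 7) (trap x a b) D" "\<forall>S\<in>D. admissible S"
    using trap_nested_partition[OF ab] by blast
  have "(\<Sum>y\<in>trap x a b. wt y * cmod (f y - weighted_mean wt f (trap x a b)) powr p)
      \<le> sharp_constant (7 * real m ^ 7 * 28) p * (\<Sum>y\<in>trap x a b. wt y * \<gamma> y powr p)"
  proof (rule nested_sharp_inequality[OF D(1) wt_pos \<gamma>])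
    fix S y assume S: "S \<in> D" "y \<in> S"
    then consider z where "S = {z}"
      | z c d where "1 \<le> c" "2 * c \<le> d" "d \<le> 8 * c" "S = trap z c d"
      using D(2) unfolding admissible_def by blast
    then show "(\<Sum>y\<in>S. wt y * cmod (f y - weighted_mean wt f S)) \<le> 28 * sum wt S * \<gamma> y"
    proof cases
      case 1
      have "weighted_mean wt f {z} = f z" using wt_pos[of z] by (simp add: weighted_mean_def)
      then show ?thesis using 1 \<gamma>[of y] wt_pos[of z] by simp
    next
      case 2
      let ?R = "trap z c (8 * c)"
      have sub: "S \<subseteq> ?R" using 2 by (auto simp: trap_def)
      have "(\<Sum>y\<in>S. wt y * cmod (f y - weighted_mean wt f S))
          \<le> 2 * (\<Sum>y\<in>S. wt y * cmod (f y - weighted_mean wt f ?R))"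
        using S finite_trap 2 by (intro mean_almost_minimizes_oscillation wt_pos) auto
      also have "\<dots> \<le> 2 * (\<Sum>y\<in>?R. wt y * cmod (f y - weighted_mean wt f ?R))"
        using sub by (intro mult_left_mono sum_mono2 finite_trap) (auto simp: wt_pos less_imp_le)
      also have "\<dots> \<le> 2 * (2 * sum wt ?R * \<gamma> y)"
        using subsetD[OF sub S(2)] by (intro mult_left_mono osc 2(1)) simp_all
      also have "\<dots> \<le> 28 * sum wt S * \<gamma> y"
      proof -
        have "real (8 * c - c) * wt z \<le> (7 * real (d - c)) * wt z"
          using 2(1-3) less_imp_le[OF wt_pos] by (intro mult_right_mono) linarith+
        then have "sum wt ?R \<le> 7 * sum wt S" unfolding 2(4) sum_wt_trap by simp
        then show ?thesis
          using mult_right_mono[of "sum wt ?R" "7 * sum wt S" "4 * \<gamma> y"] \<gamma>[of y] by simp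
      qed
      finally show ?thesis .
    qed
  qed (use m_pos p in auto)
  moreover have "7 * real m ^ 7 * 28 = 196 * real m ^ 7" by simp
  ultimately show ?thesis by (simp only:)
qed

text \<open>The top moves up two levels while the minimal depth grows by one, so that every vertex is eventually
  included and the ratio of the depths stays \<open>4\<close>.\<close>

definition exhaustion :: "'a \<Rightarrow> nat \<Rightarrow> 'a set" where
  "exhaustion r n = trap ((parent ^^ (2 * n)) r) n (4 * n)"

lemma eventually_in_exhaustion: "eventually (\<lambda>n. x \<in> exhaustion r n) sequentially"
proof -
  obtain i j where ij: "(parent ^^ i) x = (parent ^^ j) r" using common_ancestor by blast
  show ?thesis
  proof (rule eventually_sequentiallyI)
    fix n assume n: "i + j + 1 \<le> n"
    have "(parent ^^ (i + 2 * n - j)) x = (parent ^^ (2 * n - j)) ((parent ^^ i) x)"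
      using n by (simp add: add.commute flip: funpow_add[THEN fun_cong, simplified o_apply])
    also have "\<dots> = (parent ^^ (2 * n)) r"
      unfolding ij using n by (simp flip: funpow_add[THEN fun_cong, simplified o_apply])
    finally show "x \<in> exhaustion r n"
      unfolding exhaustion_def trap_def using n by (intro CollectI exI[of _ "i + 2 * n - j"]) auto
  qed
qed

lemma sum_wt_exhaustion: "sum wt (exhaustion r n) \<ge> real n * wt r"
proof -
  have "1 \<le> real m ^ (2 * n)" using m_pos by (intro one_le_power) auto
  then have "real n * (1 * wt r) \<le> real (4 * n - n) * (real m ^ (2 * n) * wt r)"
    using wt_pos[of r] by (intro mult_mono) auto
  then show ?thesis by (simp add: exhaustion_def sum_wt_trap wt_iter)
qed

end

section \<open>Levels on a homogeneous tree with a geodesic\<close>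

lemma walk_iff_relpowp: "(\<exists>xs. walk E x xs y \<and> length xs = Suc n) \<longleftrightarrow> (E ^^ n) x y"
proof (induction n arbitrary: x)
  case 0
  show ?case by (auto simp: walk_def length_Suc_conv)
next
  case (Suc n)
  show ?case
  proof
    assume "\<exists>xs. walk E x xs y \<and> length xs = Suc (Suc n)"
    then obtain x' xs where xs': "walk E x (x' # xs) y" "length xs = Suc n"
      by (metis length_Suc_conv)
    then have xs: "walk E x (x # xs) y" "length xs = Suc n" by (auto simp: walk_def)
    then have "E x (hd xs)" "walk E (hd xs) xs y" by (auto simp: walk_def successively_Cons)
    then show "(E ^^ Suc n) x y" using Suc xs by (metis relpowp_Suc_I2)
  next
    assume "(E ^^ Suc n) x y"
    then obtain z where z: "E x z" "(E ^^ n) z y" by (metis relpowp_Suc_D2)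
    then obtain xs where xs: "walk E z xs y" "length xs = Suc n" using Suc by blast
    then have "walk E x (x # xs) y" using z by (auto simp: walk_def successively_Cons)
    then show "\<exists>xs. walk E x xs y \<and> length xs = Suc (Suc n)" using xs by (metis length_Cons)
  qed
qed

lemma tdist_relpowp: "tdist E x y = (LEAST n. (E ^^ n) x y)"
  unfolding tdist_def walk_iff_relpowp ..

lemma successively_imp_rtranclp:
  assumes "successively E xs" "xs \<noteq> []" "set xs \<subseteq> S"
  shows "(\<lambda>u v. E u v \<and> u \<in> S \<and> v \<in> S)\<^sup>*\<^sup>* (hd xs) (last xs)"
  using assms
proof (induction xs)
  case (Cons x xs)
  show ?case
  proof (cases "xs = []")
    case False
    then have "E x (hd xs)" "x \<in> S" "hd xs \<in> S" using Cons.prems by (auto simp: successively_Cons)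
    then show ?thesis using Cons False
      by (auto simp: successively_Cons intro!: converse_rtranclp_into_rtranclp[of _ x "hd xs"])
  qed simp
qed simp

text \<open>Loops are cut out whenever a vertex is about to be repeated. The last conjunct records that
  the path stays in the region that is reachable by \<open>R\<close>.\<close>

lemma rtranclp_imp_path:
  assumes "R\<^sup>*\<^sup>* y z"
  shows "\<exists>xs. xs \<noteq> [] \<and> hd xs = y \<and> last xs = z \<and> successively R xs \<and> distinct xs
    \<and> (\<forall>u\<in>set xs. R\<^sup>*\<^sup>* y u)"
  using assms
proof (induction rule: converse_rtranclp_induct)
  case base
  show ?case by (rule exI[of _ "[z]"]) simp
next
  case (step y y')
  then obtain xs where xs: "xs \<noteq> []" "hd xs = y'" "last xs = z" "successively R xs" "distinct xs"
    "\<forall>u\<in>set xs. R\<^sup>*\<^sup>* y' u" by blast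
  show ?case
  proof (cases "y \<in> set xs")
    case False
    then show ?thesis using xs step(1)
      by (intro exI[of _ "y # xs"]) (auto simp: successively_Cons intro: converse_rtranclp_into_rtranclp)
  next
    case True
    then obtain us vs where "xs = us @ y # vs" by (meson split_list)
    then show ?thesis using xs step(1)
      by (intro exI[of _ "y # vs"]) (auto simp: successively_append_iff intro: converse_rtranclp_into_rtranclp)
  qed
qed

text \<open>A path from \<open>y\<close> to \<open>z\<close> that avoids their common neighbour \<open>x\<close> closes up to a cycle through \<open>x\<close>.\<close>

lemma acyclic_no_detour:
  assumes "symp E" "acyclic_graph E" "E x y" "E x z" "y \<noteq> z" "x \<noteq> y"
    and "(\<lambda>u v. E u v \<and> u \<noteq> x \<and> v \<noteq> x)\<^sup>*\<^sup>* y z"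
  shows False
proof -
  let ?R = "\<lambda>u v. E u v \<and> u \<noteq> x \<and> v \<noteq> x"
  obtain xs where xs: "xs \<noteq> []" "hd xs = y" "last xs = z" "successively ?R xs" "distinct xs"
    "\<forall>u\<in>set xs. ?R\<^sup>*\<^sup>* y u" using rtranclp_imp_path[OF assms(7)] by blast
  have "x \<notin> set xs"
  proof
    assume "x \<in> set xs"
    then have "?R\<^sup>*\<^sup>* y x" using xs by blast
    then show False using \<open>x \<noteq> y\<close> by (cases rule: rtranclp.cases) auto
  qed
  moreover have "successively E xs" using xs(4) by (rule successively_mono) auto
  moreover have "length xs \<ge> 2"
    using xs(1-3) \<open>y \<noteq> z\<close> by (cases xs; cases "tl xs") auto
  moreover have "E z x" using assms(1,4) by (meson sympD)
  ultimately have "length (x # xs) \<ge> 3 \<and> distinct (x # xs) \<and> successively E (x # xs)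
      \<and> E (last (x # xs)) (hd (x # xs))"
    using xs assms by (auto simp: successively_Cons)
  then show False using assms(2) unfolding acyclic_graph_def by blast
qed

locale tree_with_geodesic =
  fixes E :: "'a \<Rightarrow> 'a \<Rightarrow> bool" and m :: nat and g :: "'a set" and N :: "'a \<Rightarrow> int"
  assumes m_ge_1: "m \<ge> 1"
    and tree: "homogeneous_tree E m"
    and geod: "infinite_geodesic E g"
    and N_isometry: "\<forall>x\<in>g. \<forall>y\<in>g. \<bar>N x - N y\<bar> = int (tdist E x y)"
begin

lemma adj_sym: "E x y \<Longrightarrow> E y x"
  using tree by (auto simp: homogeneous_tree_def simple_graph_def dest: sympD)

lemma adj_irrefl: "\<not> E x x"
  using tree by (auto simp: homogeneous_tree_def simple_graph_def irreflp_def)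

lemma adj_connected: "E\<^sup>*\<^sup>* x y"
proof -
  obtain xs where "walk E x xs y"
    using tree unfolding homogeneous_tree_def connected_in_def by blast
  then show ?thesis using successively_imp_rtranclp[of E xs UNIV] by (simp add: walk_def)
qed

lemma relpowp_tdist: "(E ^^ tdist E x y) x y"
proof -
  obtain n where "(E ^^ n) x y" using adj_connected[of x y] rtranclp_imp_relpowp by metis
  then show ?thesis unfolding tdist_relpowp by (rule LeastI)
qed

lemma tdist_le: "(E ^^ n) x y \<Longrightarrow> tdist E x y \<le> n"
  unfolding tdist_relpowp by (rule Least_le)

lemma tdist_eq_0_iff [simp]: "tdist E x y = 0 \<longleftrightarrow> x = y"
  using relpowp_tdist[of x y] tdist_le[of 0 x y] by auto

lemma tdist_self [simp]: "tdist E x x = 0"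
  by simp

lemma tdist_step: "E x y \<Longrightarrow> tdist E x z \<le> Suc (tdist E y z)"
  using relpowp_tdist[of y z] by (intro tdist_le) (metis relpowp_Suc_I2)

lemma tdist_Suc_ex: "tdist E x z = Suc n \<Longrightarrow> \<exists>y. E x y \<and> tdist E y z = n"
proof -
  assume n: "tdist E x z = Suc n"
  then have "(E ^^ Suc n) x z" using relpowp_tdist by metis
  then obtain y where y: "E x y" "(E ^^ n) y z" by (metis relpowp_Suc_D2)
  then have "tdist E y z = n" using tdist_le[of n y z] tdist_step[of x y z] n by simp
  then show ?thesis using y by blast
qed

lemma tdist_edge: "E x y \<Longrightarrow> tdist E x y = 1"
  using tdist_step[of x y y] adj_irrefl[of x] tdist_eq_0_iff[of x y] tdist_self[of y] by fastforce

abbreviation proj :: "'a \<Rightarrow> 'a" where "proj x \<equiv> arg_min_on (tdist E x) g"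

definition gdist :: "'a \<Rightarrow> nat" where "gdist x = tdist E x (proj x)"

lemma proj_in: "proj x \<in> g"
  using geod arg_min_nat_lemma[of "\<lambda>x. x \<in> g"] by (auto simp: infinite_geodesic_def arg_min_on_def)

lemma gdist_le: "w \<in> g \<Longrightarrow> gdist x \<le> tdist E x w"
  using arg_min_nat_lemma[of "\<lambda>x. x \<in> g" w "tdist E x"] by (auto simp: gdist_def arg_min_on_def)

lemma gdist_0_iff: "gdist x = 0 \<longleftrightarrow> x \<in> g"
  using gdist_le[of x x] proj_in[of x] tdist_self[of x] by (auto simp: gdist_def)

lemma gdist_step: "E x y \<Longrightarrow> gdist x \<le> Suc (gdist y)"
  using gdist_le[OF proj_in, of x y] tdist_step[of x y "proj y"] by (simp add: gdist_def)

lemma geodesic_connected_avoiding: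
  assumes "x \<notin> g" "u \<in> g" "v \<in> g"
  shows "(\<lambda>u v. E u v \<and> u \<noteq> x \<and> v \<noteq> x)\<^sup>*\<^sup>* u v"
proof -
  obtain xs where xs: "walk E u xs v" "set xs \<subseteq> g"
    using geod assms unfolding infinite_geodesic_def connected_in_def by blast
  then have "(\<lambda>u v. E u v \<and> u \<in> g \<and> v \<in> g)\<^sup>*\<^sup>* u v"
    using successively_imp_rtranclp[of E xs g] by (simp add: walk_def)
  then show ?thesis by (rule rtranclp_mono[THEN predicate2D, rotated]) (use assms in auto)
qed

text \<open>A walk towards the geodesic that visited \<open>x\<close> after its start would reach the geodesic from \<open>x\<close> in
  fewer than \<open>gdist x\<close> steps.\<close>

lemma approach_avoids:
  assumes "(E ^^ k) y w" "w \<in> g" "k \<le> gdist x" "y \<noteq> x"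
  shows "(\<lambda>u v. E u v \<and> u \<noteq> x \<and> v \<noteq> x)\<^sup>*\<^sup>* y w"
  using assms
proof (induction k arbitrary: y)
  case (Suc k)
  then obtain z where z: "E y z" "(E ^^ k) z w" by (metis relpowp_Suc_D2)
  have "z \<noteq> x" using gdist_le[OF Suc.prems(2), of x] tdist_le[OF z(2)] Suc.prems(3) by auto
  then show ?case using z Suc by (intro converse_rtranclp_into_rtranclp[of _ y z]) auto
qed simp

text \<open>Otherwise two neighbours of \<open>x\<close> could be joined without meeting \<open>x\<close>, by walking to the geodesic, along
  it and back.\<close>

lemma closer_neighbour_unique:
  assumes "x \<notin> g" "E x y" "E x z" "gdist y \<le> gdist x" "gdist z \<le> gdist x"
  shows "y = z"
proof (rule ccontr)
  assume ne: "y \<noteq> z"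
  let ?R = "\<lambda>u v. E u v \<and> u \<noteq> x \<and> v \<noteq> x"
  have "y \<noteq> x" "z \<noteq> x" using assms adj_irrefl by auto
  then have y: "?R\<^sup>*\<^sup>* y (proj y)" and z: "?R\<^sup>*\<^sup>* z (proj z)"
    using approach_avoids[OF relpowp_tdist proj_in] assms(4,5) unfolding gdist_def by simp_all
  have "symp ?R" using adj_sym by (auto intro: sympI)
  then have "?R\<^sup>*\<^sup>* (proj z) z" using z by (meson symp_rtranclp sympD)
  then have "?R\<^sup>*\<^sup>* y z"
    using y geodesic_connected_avoiding[OF assms(1) proj_in proj_in] by (meson rtranclp_trans)
  moreover have "symp E" using adj_sym by (auto intro: sympI)
  moreover have "acyclic_graph E" using tree by (simp add: homogeneous_tree_def)
  ultimately show False using acyclic_no_detour[of E x y z] assms ne \<open>y \<noteq> x\<close> by auto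
qed

lemma closer_neighbour_ex:
  assumes "x \<notin> g"
  shows "\<exists>y. E x y \<and> gdist x = Suc (gdist y)"
proof -
  obtain n where n: "tdist E x (proj x) = Suc n"
    using assms gdist_0_iff[of x] by (cases "tdist E x (proj x)") (auto simp: gdist_def)
  then obtain y where y: "E x y" "tdist E y (proj x) = n" using tdist_Suc_ex by blast
  then have "gdist y \<le> n" using gdist_le[OF proj_in[of x], of y] by simp
  then show ?thesis using y n gdist_step[of x y] by (auto simp: gdist_def intro!: exI[of _ y])
qed

text \<open>A shortest walk to any nearest point of the geodesic starts with the only closer neighbour, so
  induction on the distance applies. The lemma makes the level independent of the choice made by \<open>arg_min_on\<close>.\<close>

lemma proj_unique: "w \<in> g \<Longrightarrow> tdist E x w = gdist x \<Longrightarrow> w = proj x"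
proof (induction "gdist x" arbitrary: x w)
  case 0
  then show ?case using gdist_def[of x] by (metis tdist_eq_0_iff)
next
  case (Suc n)
  have x: "x \<notin> g" using Suc gdist_0_iff[of x] by auto
  have toward: "\<exists>y. E x y \<and> gdist y = n \<and> tdist E y v = n" if v: "v \<in> g" "tdist E x v = gdist x" for v
  proof -
    obtain y where y: "E x y" "tdist E y v = n" using v Suc tdist_Suc_ex by metis
    then show ?thesis using gdist_le[OF v(1), of y] gdist_step[of x y] Suc.hyps(2) by auto
  qed
  obtain y where y: "E x y" "gdist y = n" "tdist E y w = n" using toward Suc.prems by blast
  obtain z where z: "E x z" "gdist z = n" "tdist E z (proj x) = n"
    using toward[OF proj_in] gdist_def by metis
  have "y = z" using closer_neighbour_unique[OF x] y z Suc.hyps(2) by simp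
  then show ?case using Suc.hyps(1)[of y] Suc.prems(1) proj_in[of x] y z by metis
qed

lemma level_geodesic: "x \<in> g \<Longrightarrow> level E g N x = N x"
  using proj_unique[of x x] gdist_0_iff[of x] by (simp add: level_def Let_def)

lemma level_closer:
  assumes "E x y" "gdist x = Suc (gdist y)"
  shows "level E g N x = level E g N y - 1"
proof -
  have "tdist E x (proj y) \<le> gdist x"
    using assms tdist_step[of x y "proj y"] by (simp add: gdist_def)
  then have "proj y = proj x"
    using gdist_le[OF proj_in[of y], of x] by (intro proj_unique proj_in) simp
  then show ?thesis using assms by (simp add: level_def Let_def gdist_def)
qed

lemma N_edge: "x \<in> g \<Longrightarrow> y \<in> g \<Longrightarrow> E x y \<Longrightarrow> \<bar>N x - N y\<bar> = 1"
  using N_isometry tdist_edge by fastforce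

lemma N_inj: "x \<in> g \<Longrightarrow> y \<in> g \<Longrightarrow> N x = N y \<Longrightarrow> x = y"
  using N_isometry by (metis abs_0 diff_self of_nat_0_eq_iff tdist_eq_0_iff)

lemma geodesic_up: "x \<in> g \<Longrightarrow> \<exists>y\<in>g. E x y \<and> N y = N x + 1"
proof -
  assume x: "x \<in> g"
  then have "card {y\<in>g. E x y} = 2" using geod by (auto simp: infinite_geodesic_def)
  then obtain u v where uv: "{y\<in>g. E x y} = {u, v}" "u \<noteq> v" by (auto simp: card_2_iff)
  then have "u \<in> g" "E x u" "v \<in> g" "E x v" by auto
  moreover from this have "N u \<noteq> N v" using N_inj uv by blast
  ultimately show ?thesis using N_edge[OF x, of u] N_edge[OF x, of v] by (smt (verit))
qed

lemma neighbour_off_geodesic: "x \<in> g \<Longrightarrow> E x y \<Longrightarrow> y \<notin> g \<Longrightarrow> gdist y = Suc (gdist x)"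
  using gdist_step[OF adj_sym, of x y] gdist_0_iff[of x] gdist_0_iff[of y] by simp

lemma level_edge: "E x y \<Longrightarrow> \<bar>level E g N x - level E g N y\<bar> = 1"
proof (cases "x \<in> g \<and> y \<in> g")
  case True
  then show "E x y \<Longrightarrow> ?thesis" using N_edge level_geodesic by simp
next
  case False
  assume xy: "E x y"
  have "gdist x \<noteq> gdist y"
  proof
    assume eq: "gdist x = gdist y"
    then have x: "x \<notin> g" using False gdist_0_iff by metis
    then obtain z where "E x z" "gdist x = Suc (gdist z)" using closer_neighbour_ex by blast
    then show False using closer_neighbour_unique[OF x xy, of z] eq by auto
  qed
  then have "gdist x = Suc (gdist y) \<or> gdist y = Suc (gdist x)"
    using gdist_step[OF xy] gdist_step[OF adj_sym[OF xy]] by linarith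
  then show ?thesis using level_closer xy adj_sym[OF xy] by fastforce
qed

text \<open>Off the geodesic the upper neighbour is the one closer to the geodesic; on it, it is the successor along the
  geodesic, where \<open>N\<close> increases.\<close>

lemma unique_upper_neighbour: "\<exists>!y. E x y \<and> level E g N y = level E g N x + 1"
proof (cases "x \<in> g")
  case True
  obtain y where y: "y \<in> g" "E x y" "N y = N x + 1" using geodesic_up True by blast
  show ?thesis
  proof (intro ex1I[of _ y])
    show "E x y \<and> level E g N y = level E g N x + 1" using y True level_geodesic by simp
    fix z assume z: "E x z \<and> level E g N z = level E g N x + 1"
    show "z = y"
    proof (cases "z \<in> g")
      case zg: True
      then show ?thesis using z y True level_geodesic N_inj by simp
    next
      case False
      then show ?thesis
        using level_closer[OF adj_sym neighbour_off_geodesic, of x z] True z by auto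
    qed
  qed
next
  case False
  obtain y where y: "E x y" "gdist x = Suc (gdist y)" using closer_neighbour_ex False by blast
  show ?thesis
  proof (intro ex1I[of _ y])
    show "E x y \<and> level E g N y = level E g N x + 1" using y level_closer by simp
    fix z assume z: "E x z \<and> level E g N z = level E g N x + 1"
    show "z = y"
    proof (rule ccontr)
      assume "z \<noteq> y"
      then have "\<not> gdist z \<le> gdist x" using closer_neighbour_unique[OF False] z y by auto
      then have "gdist z = Suc (gdist x)" using gdist_step[OF adj_sym, of x z] z by simp
      then show False using level_closer[OF adj_sym, of x z] z by simp
    qed
  qed
qed

definition parent :: "'a \<Rightarrow> 'a" where
  "parent x = (THE y. E x y \<and> level E g N y = level E g N x + 1)"

lemma parent_edge: "E x (parent x)" and level_parent: "level E g N (parent x) = level E g N x + 1"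
  using theI'[OF unique_upper_neighbour, of x] by (auto simp: parent_def)

lemma parent_iff: "parent x = y \<longleftrightarrow> E x y \<and> level E g N y = level E g N x + 1"
  using unique_upper_neighbour[of x] parent_edge level_parent by metis

lemma neighbour_cases: "E x y \<Longrightarrow> y = parent x \<or> x = parent y"
  using level_edge[of x y] parent_iff[of x y] parent_iff[of y x] adj_sym by (smt (verit))

lemma children_eq: "{y. parent y = x} = {y. E x y} - {parent x}"
  using neighbour_cases[of x] parent_edge adj_sym level_parent by (auto dest: arg_cong[of _ _ "level E g N"])

sublocale rooted_at_infinity parent "level E g N" m
proof
  show "m \<ge> 1" by (rule m_ge_1)
  show "level E g N (parent x) = level E g N x + 1" for x by (rule level_parent)
  show "card {y. parent y = x} = m" for x
    using tree parent_edge[of x] by (simp add: children_eq homogeneous_tree_def card_Diff_singleton)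
  show "\<exists>i j. (parent ^^ i) x = (parent ^^ j) y" for x y
    using adj_connected[of x y]
  proof (induction rule: converse_rtranclp_induct)
    case base
    then show ?case by blast
  next
    case (step u v)
    then obtain i j where ij: "(parent ^^ i) v = (parent ^^ j) y" by blast
    from neighbour_cases[OF step(1)] show ?case
    proof
      assume "v = parent u"
      then have "(parent ^^ Suc i) u = (parent ^^ j) y" using ij by (simp add: funpow_swap1)
      then show ?thesis by blast
    next
      assume "u = parent v"
      then have "(parent ^^ i) u = (parent ^^ Suc j) y" using ij by (simp flip: funpow_swap1)
      then show ?thesis by blast
    qed
  qed
qed

lemma level_lipschitz: "(E ^^ n) x y \<Longrightarrow> level E g N y \<le> level E g N x + int n"
proof (induction n arbitrary: x)
  case (Suc n)
  then obtain z where "E x z" "(E ^^ n) z y" by (metis relpowp_Suc_D2)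
  then show ?case using Suc.IH[of z] level_edge[of x z] by linarith
qed simp

text \<open>A walk of length \<open>n\<close> that gains \<open>n\<close> levels has to climb at every step, and the only way to climb is to
  move to the parent.\<close>

lemma below_iff: "below E g N y x \<longleftrightarrow> (\<exists>k. (parent ^^ k) y = x)"
proof
  have "(parent ^^ n) y = x" if "(E ^^ n) y x" "level E g N x = level E g N y + int n" for n
    using that
  proof (induction n arbitrary: y)
    case (Suc n)
    then obtain z where z: "E y z" "(E ^^ n) z x" by (metis relpowp_Suc_D2)
    then have "level E g N z = level E g N y + 1"
      using level_lipschitz[OF z(2)] level_edge[OF z(1)] Suc.prems(2) by linarith
    moreover from this have "z = parent y" using z parent_iff by metis
    moreover have "(parent ^^ n) z = x" using Suc.prems(2) calculation(1) by (intro Suc.IH z(2)) simp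
    ultimately show ?case by (simp add: funpow_swap1)
  qed simp
  then show "below E g N y x \<Longrightarrow> \<exists>k. (parent ^^ k) y = x"
    using relpowp_tdist[of y x] unfolding below_def by fastforce
next
  assume "\<exists>k. (parent ^^ k) y = x"
  then obtain k where k: "(parent ^^ k) y = x" by blast
  have walk: "(E ^^ k) y ((parent ^^ k) y)" for k
    by (induction k) (auto intro: parent_edge)
  have "tdist E y x \<le> k" using walk[of k] k tdist_le by metis
  moreover have "level E g N x = level E g N y + int k" using lev_iter[of k y] k by simp
  moreover have "level E g N x \<le> level E g N y + int (tdist E y x)"
    using level_lipschitz relpowp_tdist by blast
  ultimately show "below E g N y x" by (simp add: below_def)
qed

text \<open>This is the Calderon--Zygmund set with \<open>h = 2 * a\<close>.\<close>

lemma trap_CZ: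
  assumes "1 \<le> a"
  shows "trap x a (8 * a) \<in> CZ_sets E g N"
proof -
  have "trap x a (8 * a) = {y. below E g N y x \<and>
      real_of_int (2 * int a) / 2 \<le> real_of_int (level E g N x - level E g N y) \<and>
      level E g N x - level E g N y < 4 * (2 * int a)}"
    unfolding trap_def below_iff using lev_iter by fastforce
  then show ?thesis unfolding CZ_sets_def using assms
    by (intro CollectI disjI2 exI[of _ x] exI[of _ "2 * int a"] conjI) simp_all
qed

end

section \<open>The sharp maximal inequality\<close>

lemma ennreal_powr_ennreal: "a \<ge> 0 \<Longrightarrow> ennreal_powr (ennreal a) p = ennreal (a powr p)"
  by (simp add: ennreal_powr_def)

lemma ennreal_powr_finite_iff: "ennreal_powr a p = \<infinity> \<longleftrightarrow> a = \<infinity>"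
  by (simp add: ennreal_powr_def)

context tree_with_geodesic
begin

abbreviation "\<mu> \<equiv> tree_measure E m g N"

lemma tree_measure_wt: "\<mu> = density (count_space UNIV) (\<lambda>x. ennreal (wt x))"
  by (simp add: tree_measure_def point_measure_def wt_def)

lemma AE_tree_measure: "(AE x in \<mu>. P x) \<longleftrightarrow> (\<forall>x. P x)"
  unfolding tree_measure_wt using wt_pos by (simp add: AE_density AE_count_space)

lemma measurable_tree_measure [simp, measurable]: "h \<in> measurable \<mu> M \<longleftrightarrow> h \<in> UNIV \<rightarrow> space M"
  by (simp add: tree_measure_def)

lemma nn_integral_finite_set:
  assumes "finite R" "\<And>x. h x \<ge> 0"
  shows "(\<integral>\<^sup>+x. ennreal (h x) * indicator R x \<partial>\<mu>) = ennreal (\<Sum>x\<in>R. wt x * h x)"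
proof -
  have "(\<integral>\<^sup>+x. ennreal (h x) * indicator R x \<partial>\<mu>)
      = (\<integral>\<^sup>+x. ennreal (wt x) * (ennreal (h x) * indicator R x) \<partial>count_space UNIV)"
    unfolding tree_measure_wt by (simp add: nn_integral_density)
  also have "\<dots> = (\<Sum>x\<in>R. ennreal (wt x) * (ennreal (h x) * indicator R x))"
    using assms by (intro nn_integral_count_space') auto
  also have "\<dots> = (\<Sum>x\<in>R. ennreal (wt x * h x))"
    using assms wt_pos by (intro sum.cong) (auto simp: ennreal_mult less_imp_le)
  also have "\<dots> = ennreal (\<Sum>x\<in>R. wt x * h x)"
    using assms wt_pos by (intro sum_ennreal) (simp add: less_imp_le)
  finally show ?thesis .
qed

lemma emeasure_finite_set: "finite R \<Longrightarrow> emeasure \<mu> R = ennreal (sum wt R)"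
  using nn_integral_finite_set[of R "\<lambda>_. 1"] by (simp add: tree_measure_def sets_point_measure)

lemma measure_finite_set: "finite R \<Longrightarrow> measure \<mu> R = sum wt R"
  using emeasure_finite_set[of R] wt_pos
  by (simp add: Sigma_Algebra.measure_def sum_nonneg less_imp_le)

lemma average_eq_weighted_mean:
  assumes "finite R"
  shows "average \<mu> R f = weighted_mean wt f R"
proof -
  have "complex_set_lebesgue_integral \<mu> R f
      = (\<integral>x. wt x *\<^sub>R (indicator R x *\<^sub>R f x) \<partial>count_space UNIV)"
    unfolding set_lebesgue_integral_def tree_measure_wt
    using wt_pos by (intro integral_density) (auto simp: less_imp_le)
  also have "\<dots> = (\<Sum>x | x \<in> UNIV \<and> wt x *\<^sub>R (indicator R x *\<^sub>R f x) \<noteq> 0. wt x *\<^sub>R (indicator R x *\<^sub>R f x))"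
    by (intro lebesgue_integral_count_space_finite_support finite_subset[OF _ assms]) (auto simp: indicator_def)
  also have "\<dots> = (\<Sum>x\<in>R. wt x *\<^sub>R f x)"
    using assms by (intro sum.mono_neutral_cong_left) (auto simp: indicator_def)
  finally show ?thesis
    by (simp add: average_def weighted_mean_def measure_finite_set[OF assms] scaleR_conv_of_real divide_inverse mult.commute)
qed

lemma mean_oscillation_finite_set:
  assumes "finite R" "R \<noteq> {}"
  shows "mean_oscillation \<mu> q R f
    = ennreal (((\<Sum>x\<in>R. wt x * cmod (f x - weighted_mean wt f R) powr q) / sum wt R) powr (1 / q))"
proof -
  have pos: "sum wt R > 0" using assms wt_pos by (intro sum_pos) auto
  have nn: "(\<Sum>x\<in>R. wt x * cmod (f x - weighted_mean wt f R) powr q) \<ge> 0"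
    using wt_pos by (intro sum_nonneg) (simp add: less_imp_le)
  have "(\<integral>\<^sup>+x. ennreal (cmod (f x - weighted_mean wt f R) powr q) * indicator R x \<partial>\<mu>)
      = ennreal (\<Sum>x\<in>R. wt x * cmod (f x - weighted_mean wt f R) powr q)"
    using assms by (intro nn_integral_finite_set) auto
  then show ?thesis
    using assms pos nn
    by (simp add: mean_oscillation_def average_eq_weighted_mean emeasure_finite_set divide_ennreal ennreal_powr_ennreal)
qed

lemma oscillation_le_sharp:
  assumes q: "q > 1" and a: "1 \<le> a" and y: "y \<in> trap x a (8 * a)"
    and fin: "sharp_maximal E m g N q f y \<noteq> \<infinity>"
  defines "R \<equiv> trap x a (8 * a)"
  shows "(\<Sum>z\<in>R. wt z * cmod (f z - weighted_mean wt f R))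
    \<le> 2 * sum wt R * enn2real (sharp_maximal E m g N q f y)"
proof -
  let ?osc = "((\<Sum>x\<in>R. wt x * cmod (f x - weighted_mean wt f R) powr q) / sum wt R) powr (1 / q)"
  have R: "finite R" "R \<noteq> {}" using y finite_trap by (auto simp: R_def)
  have "mean_oscillation \<mu> q R f \<le> sharp_maximal E m g N q f y"
    unfolding sharp_maximal_def using trap_CZ[OF a, of x] y by (intro SUP_upper) (simp add: R_def)
  then have "ennreal ?osc \<le> ennreal (enn2real (sharp_maximal E m g N q f y))"
    using fin by (simp add: mean_oscillation_finite_set[OF R] ennreal_enn2real less_top)
  then have "?osc \<le> enn2real (sharp_maximal E m g N q f y)" by simp
  moreover have "(\<Sum>z\<in>R. wt z * cmod (f z - weighted_mean wt f R)) \<le> 2 * sum wt R * ?osc"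
    using R q wt_pos by (intro weighted_power_mean_bound) auto
  moreover have "sum wt R \<ge> 0" using wt_pos by (intro sum_nonneg) (simp add: less_imp_le)
  ultimately show ?thesis by (meson mult_left_mono mult_nonneg_nonneg order_trans zero_le_numeral)
qed

text \<open>The mean of \<open>\<bar>f\<bar>\<close> is controlled by the \<open>q\<close>-th power mean, where the bounded integral of
  \<open>\<bar>f\<bar> powr q\<close> is divided by a weight that tends to infinity.\<close>

lemma mean_over_exhaustion_tendsto_0:
  assumes q: "q > 1" and f: "f \<in> Lp_space \<mu> q"
  shows "(\<lambda>n. weighted_mean wt f (exhaustion r n)) \<longlonglongrightarrow> 0"
proof -
  define F where "F = enn2real (\<integral>\<^sup>+x. ennreal (cmod (f x) powr q) \<partial>\<mu>)"
  have "(\<integral>\<^sup>+x. ennreal (cmod (f x) powr q) \<partial>\<mu>) \<noteq> \<infinity>"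
    using f by (auto simp: Lp_space_def Lp_norm_def ennreal_powr_ennreal ennreal_powr_def split: if_splits)
  then have F: "(\<integral>\<^sup>+x. ennreal (cmod (f x) powr q) \<partial>\<mu>) = ennreal F"
    by (simp add: F_def less_top)
  have F0: "F \<ge> 0" by (simp add: F_def)
  have bound: "cmod (weighted_mean wt f (exhaustion r n)) \<le> 2 * (F / (real n * wt r)) powr (1 / q)"
    if n: "n \<ge> 1" for n
  proof -
    let ?Q = "exhaustion r n"
    have Q: "finite ?Q" "?Q \<noteq> {}"
      using n finite_trap trap_nonempty unfolding exhaustion_def by auto
    have pos: "real n * wt r > 0" using n wt_pos[of r] by simp
    then have W: "sum wt ?Q > 0" using sum_wt_exhaustion[of n r] by linarith
    have "ennreal (\<Sum>x\<in>?Q. wt x * cmod (f x) powr q)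
        = (\<integral>\<^sup>+x. ennreal (cmod (f x) powr q) * indicator ?Q x \<partial>\<mu>)"
      using Q by (subst nn_integral_finite_set) auto
    also have "\<dots> \<le> ennreal F"
      unfolding F[symmetric] by (intro nn_integral_mono) (simp add: indicator_def)
    finally have le: "(\<Sum>x\<in>?Q. wt x * cmod (f x) powr q) \<le> F"
      using F0 by (simp add: ennreal_le_iff)
    have "sum wt ?Q * cmod (weighted_mean wt f ?Q) \<le> (\<Sum>x\<in>?Q. wt x * cmod (f x))"
      using norm_weighted_mean_diff_le[of wt ?Q f 0] Q wt_pos by simp
    also have "\<dots> \<le> 2 * sum wt ?Q * ((\<Sum>x\<in>?Q. wt x * cmod (f x) powr q) / sum wt ?Q) powr (1 / q)"
      using Q q wt_pos by (intro weighted_power_mean_bound) auto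
    also have "\<dots> \<le> 2 * sum wt ?Q * (F / (real n * wt r)) powr (1 / q)"
      using W pos q le F0 sum_wt_exhaustion[of n r] wt_pos
      by (intro mult_left_mono powr_mono2 frac_le divide_nonneg_nonneg sum_nonneg) (auto simp: less_imp_le)
    finally show ?thesis using W by simp
  qed
  have "(\<lambda>n. F / wt r / real n) \<longlonglongrightarrow> 0" by (rule lim_const_over_n)
  then have "(\<lambda>n. F / (real n * wt r)) \<longlonglongrightarrow> 0" by (simp add: field_simps)
  then have "(\<lambda>n. 2 * (F / (real n * wt r)) powr (1 / q)) \<longlonglongrightarrow> 2 * 0 powr (1 / q)"
    using q F0 wt_pos by (intro tendsto_intros tendsto_powr') (auto simp: less_imp_le)
  then have "(\<lambda>n. 2 * (F / (real n * wt r)) powr (1 / q)) \<longlonglongrightarrow> 0" by simp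
  then show ?thesis
    by (rule Lim_null_comparison[rotated]) (auto intro: eventually_sequentiallyI[of 1] bound)
qed

text \<open>Where the sharp function is infinite the integral on the right is infinite, since every point has
  positive measure; so the hypothesis lets the sharp function be treated as real-valued, and Fatou's lemma applies along the exhaustion.\<close>

lemma integral_sharp_inequality:
  assumes p: "p > 1" and q: "q > 1" and f: "f \<in> Lp_space \<mu> q"
    and fin: "(\<integral>\<^sup>+x. ennreal_powr (sharp_maximal E m g N q f x) p \<partial>\<mu>) \<noteq> \<infinity>"
  shows "(\<integral>\<^sup>+x. ennreal (cmod (f x) powr p) \<partial>\<mu>)
    \<le> ennreal (sharp_constant (196 * real m ^ 7) p) * (\<integral>\<^sup>+x. ennreal_powr (sharp_maximal E m g N q f x) p \<partial>\<mu>)"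
    (is "_ \<le> ennreal ?C * ?J")
proof -
  have "AE x in \<mu>. ennreal_powr (sharp_maximal E m g N q f x) p \<noteq> \<infinity>"
    using fin by (intro nn_integral_PInf_AE) auto
  then have finite_sharp: "sharp_maximal E m g N q f x \<noteq> \<infinity>" for x
    unfolding AE_tree_measure ennreal_powr_finite_iff by blast
  define \<gamma> where "\<gamma> x = enn2real (sharp_maximal E m g N q f x)" for x
  have J: "?J = (\<integral>\<^sup>+x. ennreal (\<gamma> x powr p) \<partial>\<mu>)"
    using finite_sharp by (simp add: ennreal_powr_def \<gamma>_def)
  have C: "?C > 0" using m_pos p by (intro sharp_constant_pos) auto
  \<comment> \<open>Any vertex serves as the base point of the exhaustion.\<close>
  fix r :: 'a
  define Q where "Q n = exhaustion r n" for n
  define a where "a n = weighted_mean wt f (Q n)" for n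
  define u where "u n x = ennreal (cmod (f x - a n) powr p) * indicator (Q n) x" for n x
  have u_le: "(\<integral>\<^sup>+x. u n x \<partial>\<mu>) \<le> ennreal ?C * ?J" if n: "n \<ge> 1" for n
  proof -
    have Q: "finite (Q n)" using finite_trap by (simp add: Q_def exhaustion_def)
    have "(\<Sum>x\<in>Q n. wt x * cmod (f x - a n) powr p) \<le> ?C * (\<Sum>x\<in>Q n. wt x * \<gamma> x powr p)"
      unfolding a_def Q_def exhaustion_def
    proof (rule trap_sharp_inequality[OF p])
      fix x a y assume "1 \<le> a" "y \<in> trap x a (8 * a)"
      then show "(\<Sum>z\<in>trap x a (8 * a). wt z * cmod (f z - weighted_mean wt f (trap x a (8 * a))))
          \<le> 2 * sum wt (trap x a (8 * a)) * \<gamma> y"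
        unfolding \<gamma>_def using q finite_sharp by (intro oscillation_le_sharp) auto
    qed (use n in \<open>auto simp: \<gamma>_def\<close>)
    then have "(\<integral>\<^sup>+x. u n x \<partial>\<mu>) \<le> ennreal (?C * (\<Sum>x\<in>Q n. wt x * \<gamma> x powr p))"
      unfolding u_def using Q by (subst nn_integral_finite_set) (auto intro: ennreal_leI)
    also have "\<dots> = ennreal ?C * (\<integral>\<^sup>+x. ennreal (\<gamma> x powr p) * indicator (Q n) x \<partial>\<mu>)"
      using Q C wt_pos by (subst nn_integral_finite_set) (auto simp: ennreal_mult sum_nonneg less_imp_le)
    also have "\<dots> \<le> ennreal ?C * ?J"
      unfolding J by (intro mult_left_mono nn_integral_mono) (auto simp: indicator_def)
    finally show ?thesis .
  qed
  have u_lim: "(\<lambda>n. u n x) \<longlonglongrightarrow> ennreal (cmod (f x) powr p)" for x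
  proof -
    have "a \<longlonglongrightarrow> 0" unfolding a_def Q_def using q f by (rule mean_over_exhaustion_tendsto_0)
    then have "(\<lambda>n. cmod (f x - a n) powr p) \<longlonglongrightarrow> cmod (f x - 0) powr p"
      using p by (intro tendsto_powr' tendsto_intros) auto
    then have "(\<lambda>n. ennreal (cmod (f x - a n) powr p)) \<longlonglongrightarrow> ennreal (cmod (f x) powr p)"
      by (intro tendsto_ennrealI) simp
    moreover have "\<forall>\<^sub>F n in sequentially. ennreal (cmod (f x - a n) powr p) = u n x"
      using eventually_in_exhaustion[of x r] by eventually_elim (simp add: u_def Q_def)
    ultimately show ?thesis by (rule Lim_transform_eventually)
  qed
  have "(\<integral>\<^sup>+x. ennreal (cmod (f x) powr p) \<partial>\<mu>) = (\<integral>\<^sup>+x. liminf (\<lambda>n. u n x) \<partial>\<mu>)"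
    using lim_imp_Liminf[OF sequentially_bot u_lim] by simp
  also have "\<dots> \<le> liminf (\<lambda>n. \<integral>\<^sup>+x. u n x \<partial>\<mu>)"
    by (intro nn_integral_liminf) simp
  also have "\<dots> \<le> ennreal ?C * ?J"
    using u_le by (intro Liminf_le) (auto intro: eventually_sequentiallyI[of 1])
  finally show ?thesis .
qed

lemma Lp_sharp_inequality:
  assumes p: "p > 1" and q: "q > 1" and f: "f \<in> Lp_space \<mu> q"
  shows "Lp_norm \<mu> p (\<lambda>x. ennreal (cmod (f x)))
    \<le> ennreal (sharp_constant (196 * real m ^ 7) p powr (1 / p)) * Lp_norm \<mu> p (sharp_maximal E m g N q f)"
    (is "_ \<le> ennreal (?C powr _) * _")
proof -
  have C: "?C > 0" using m_pos p by (intro sharp_constant_pos) auto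
  define J where "J = (\<integral>\<^sup>+x. ennreal_powr (sharp_maximal E m g N q f x) p \<partial>\<mu>)"
  define A where "A = (\<integral>\<^sup>+x. ennreal (cmod (f x) powr p) \<partial>\<mu>)"
  have norms: "Lp_norm \<mu> p (\<lambda>x. ennreal (cmod (f x))) = ennreal_powr A (1 / p)"
    "Lp_norm \<mu> p (sharp_maximal E m g N q f) = ennreal_powr J (1 / p)"
    by (simp_all add: Lp_norm_def A_def J_def ennreal_powr_ennreal)
  show ?thesis
  proof (cases "J = \<infinity>")
    case True
    then have "ennreal_powr J (1 / p) = \<infinity>" by (simp add: ennreal_powr_def)
    then show ?thesis using C by (simp add: norms ennreal_mult_eq_top_iff ennreal_mult_top)
  next
    case False
    then obtain j where j: "J = ennreal j" "j \<ge> 0" by (cases J) auto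
    have "A \<le> ennreal ?C * J"
      unfolding A_def J_def using p q f False by (intro integral_sharp_inequality) (auto simp: J_def)
    then have AJ: "A \<le> ennreal (?C * j)" using j C by (simp add: ennreal_mult less_imp_le)
    then obtain a where a: "A = ennreal a" "a \<ge> 0" by (cases A) (auto simp: top_unique)
    then have "a \<le> ?C * j" using AJ j C by simp
    then have "a powr (1 / p) \<le> ?C powr (1 / p) * j powr (1 / p)"
      using a j C p by (simp flip: powr_mult add: powr_mono2)
    then show ?thesis
      using a j by (simp add: norms ennreal_powr_ennreal flip: ennreal_mult)
  qed
qed

end

theorem theorem20:
  fixes E :: "'a \<Rightarrow> 'a \<Rightarrow> bool" and m :: nat
    and g\<^sub>0 :: "'a set" and N :: "'a \<Rightarrow> int"
    and p p\<^sub>0 :: real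
  assumes "m \<ge> 2"
    and "homogeneous_tree E m"
    and "infinite_geodesic E g\<^sub>0"
    and "\<forall>x\<in>g\<^sub>0. \<forall>y\<in>g\<^sub>0. \<bar>N x - N y\<bar> = int (tdist E x y)"
    and "1 < p" and "1 < p\<^sub>0" and "p\<^sub>0 < p"
  shows "\<exists>C::real. C > 0 \<and>
    (\<forall>f \<in> Lp_space (tree_measure E m g\<^sub>0 N) p\<^sub>0.
      Lp_norm (tree_measure E m g\<^sub>0 N) p (\<lambda>x. ennreal (cmod (f x)))
        \<le> ennreal C * Lp_norm (tree_measure E m g\<^sub>0 N) p (sharp_maximal E m g\<^sub>0 N p\<^sub>0 f))"
proof -
  interpret tree_with_geodesic E m g\<^sub>0 N
    using assms by unfold_locales auto
  have "sharp_constant (196 * real m ^ 7) p powr (1 / p) > 0"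
    using sharp_constant_pos[of "196 * real m ^ 7" p] assms by simp
  then show ?thesis using Lp_sharp_inequality[OF assms(5,6)] by blast
qed

end
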